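(* Let $T>0$, $N\ge 2$, let $\{\boldsymbol{q}_0^{(n)}\}_{n=1}^N$ be i.i.d. with density $f_0$, let the test functions $\varphi_1,\dots,\varphi_K$ be continuous and bounded on $\mathbb{R}^{d_x}$, and for $\boldsymbol{\alpha}\in\mathcal{A}$ set $$\boldsymbol{q}_T^{(n)}:=\Phi_T(\boldsymbol{q}_0^{(n)};\boldsymbol{\alpha}),\qquad \mu_k^{(n)}:=\varphi_k(\Pi_{\boldsymbol{X}}\boldsymbol{q}_T^{(n)}),\qquad G^{(n)}:=G(\boldsymbol{q}_T^{(n)},T;\boldsymbol{\alpha}).$$ Then, in the setting of the context, the crossed estimator $$\widehat{\boldsymbol{g}}=\widehat{\partial_{\boldsymbol{\alpha}}\mathcal{J}_K}:=\sum_{k=1}^K\frac{1}{N(N-1)}\sum_{1\le i\ne j\le N}\bigl(\mu_k^{(i)}-\tilde\mu_k\bigr)\,\mu_k^{(j)}\,G^{(j)}$$ is an unbiased estimator of the gradient of the weak loss, $\partial_{\boldsymbol{\alpha}}\mathcal{J}_K(\boldsymbol{\alpha})=\sum_{k=1}^K(\mu_k(\boldsymbol{\alpha})-\tilde\mu_k)\,\partial_{\boldsymbol{\alpha}}\mu_k(\boldsymbol{\alpha})$: $$\mathbb{E}\bigl[\widehat{\partial_{\boldsymbol{\alpha}}\mathcal{J}_K}\bigr]=\partial_{\boldsymbol{\alpha}}\mathcal{J}_K(\boldsymbol{\alpha}).$$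
   Context: Setting. $\mathcal{A}\subset\mathbb{R}^p$ is open. The vector field $\boldsymbol{R}:\mathbb{R}^d\times[0,T]\times\mathcal{A}\to\mathbb{R}^d$, written $\boldsymbol{R}(\boldsymbol{q},t;\boldsymbol{\alpha})$, is $C^1$ in $(\boldsymbol{q},t,\boldsymbol{\alpha})$ and globally Lipschitz in $\boldsymbol{q}$ uniformly in $(t,\boldsymbol{\alpha})$, with $L_R:=\sup_{(\boldsymbol{q},t,\boldsymbol{\alpha})}\|\nabla_{\boldsymbol{q}}\boldsymbol{R}(\boldsymbol{q},t;\boldsymbol{\alpha})\|<\infty$. The divergence $h_{\boldsymbol{\alpha}}(\boldsymbol{q},t):=\nabla_{\boldsymbol{q}}\cdot\boldsymbol{R}(\boldsymbol{q},t;\boldsymbol{\alpha})$ is $C^1$ in $(\boldsymbol{q},\boldsymbol{\alpha})$, and $\partial_{\boldsymbol{\alpha}}h_{\boldsymbol{\alpha}}$ and $\nabla_{\boldsymbol{q}}h_{\boldsymbol{\alpha}}$ are bounded, uniformly in $(t,\boldsymbol{\alpha})$, on every bounded set of states $\boldsymbol{q}$. The initial density $f_0$ is a probability density on $\mathbb{R}^d$ with support $\Omega\subseteq\mathbb{R}^d$; it is $C^1$ and strictly positive on the interior $\Omega^{\circ}$ of $\Omega$, $\Omega^{\circ}$ has full $f_0$-measure, and $\mathbb{E}_{\boldsymbol{q}_0\sim f_0}\|\nabla\log f_0(\boldsymbol{q}_0)\|^2<\infty$ (gradient taken on $\Omega^{\circ}$). Flow map and density. For $\boldsymbol{q}_0\in\mathbb{R}^d$,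 $t\mapsto\Phi_t(\boldsymbol{q}_0;\boldsymbol{\alpha})$ is the unique solution on $[0,T]$ of $\dot{\boldsymbol{q}}=\boldsymbol{R}(\boldsymbol{q},t;\boldsymbol{\alpha})$, $\boldsymbol{q}(0)=\boldsymbol{q}_0$; each $\Phi_t(\cdot;\boldsymbol{\alpha})$ is a $C^1$ diffeomorphism of $\mathbb{R}^d$. $f(\cdot,t\mid\boldsymbol{\alpha})$ denotes the density of the pushforward $(\Phi_t(\cdot;\boldsymbol{\alpha}))_{\#}f_0$; it belongs to $C^1(\mathbb{R}^d\times[0,T])$ and solves the Liouville equation $\partial_t f+\nabla_{\boldsymbol{Q}}\cdot(f\boldsymbol{R})=0$ with $f(\cdot,0\mid\boldsymbol{\alpha})=f_0$. Observation. $d=d_x+d_y$, $\mathbb{R}^d\ni\boldsymbol{Q}=(\boldsymbol{X},\boldsymbol{Y})$ with $\boldsymbol{X}\in\mathbb{R}^{d_x}$ observed and $\boldsymbol{Y}\in\mathbb{R}^{d_y}$ latent; $\Pi_{\boldsymbol{X}}(\boldsymbol{X},\boldsymbol{Y})=\boldsymbol{X}$. The marginal $f_{\boldsymbol{x}}(\boldsymbol{X},t\mid\boldsymbol{\alpha}):=\int_{\mathbb{R}^{d_y}}f(\boldsymbol{X},\boldsymbol{Y},t\mid\boldsymbol{\alpha})\,d\boldsymbol{Y}$ is assumed weakly differentiable with respect to $\boldsymbol{\alpha}$ with $\partial_{\boldsymbol{\alpha}}f_{\boldsymbol{x}}(\cdot,t\mid\boldsymbol{\alpha})\in L^1(\mathbb{R}^{d_x})$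 for all $t\in[0,T]$, $\boldsymbol{\alpha}\in\mathcal{A}$. Weak loss. $\mu_k(\boldsymbol{\alpha}):=\int_{\mathbb{R}^{d_x}}\varphi_k(\boldsymbol{X})f_{\boldsymbol{x}}(\boldsymbol{X},T\mid\boldsymbol{\alpha})\,d\boldsymbol{X}=\mathbb{E}_{\boldsymbol{q}_0\sim f_0}[\varphi_k(\Pi_{\boldsymbol{X}}\Phi_T(\boldsymbol{q}_0;\boldsymbol{\alpha}))]$; $\tilde\mu_k:=\int\varphi_k(\boldsymbol{X})\tilde f_{\boldsymbol{x}}(\boldsymbol{X},T)\,d\boldsymbol{X}$, where $\tilde f_{\boldsymbol{x}}(\cdot,T)$ is a given (observed) probability density on $\mathbb{R}^{d_x}$; and $\mathcal{J}_K(\boldsymbol{\alpha}):=\tfrac12\sum_{k=1}^K(\tilde\mu_k-\mu_k(\boldsymbol{\alpha}))^2$. Eulerian sensitivity. For $\boldsymbol{Q}_T$ with $\Phi_T^{-1}(\boldsymbol{Q}_T;\boldsymbol{\alpha})\in\Omega^{\circ}$, $G(\boldsymbol{Q}_T,T;\boldsymbol{\alpha}):=\partial_{\boldsymbol{\alpha}}\log f(\boldsymbol{Q}_T,T\mid\boldsymbol{\alpha})\in\mathbb{R}^p$, the derivative being taken with $\boldsymbol{Q}_T$ held fixed; thus $G(\Phi_T(\boldsymbol{q}_0;\boldsymbol{\alpha}),T;\boldsymbol{\alpha})$ is defined for $f_0$-almost every $\boldsymbol{q}_0$.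
   Formalization: The formal version also assumes that the joint density f(·,T|α) is weakly differentiable in α at the given α with L¹ derivative, against bounded continuous tests; with only the marginal weakly differentiable the claim can fail for unbounded Ω. For bounded Ω this is automatic. *)

theory Defs
  imports "HOL-Probability.Probability"
begin

text \<open>Derivatives are taken within \<open>S\<close>, hence one-sided at the end points of a closed time
  interval.\<close>

definition C1_on :: "'a::euclidean_space set \<Rightarrow> ('a \<Rightarrow> 'b::euclidean_space) \<Rightarrow> bool" where
  "C1_on S F \<longleftrightarrow> (\<exists>F' :: 'a \<Rightarrow> 'a \<Rightarrow>\<^sub>L 'b.
     (\<forall>x\<in>S. (F has_derivative blinfun_apply (F' x)) (at x within S)) \<and> continuous_on S F')"

definition gradient :: "('a::euclidean_space \<Rightarrow> real) \<Rightarrow> 'a \<Rightarrow> 'a" where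
  "gradient F x = (THE D. GDERIV F x :> D)"

definition divergence :: "('a::euclidean_space \<Rightarrow> 'a) \<Rightarrow> 'a \<Rightarrow> real" where
  "divergence F x = (\<Sum>b\<in>Basis. frechet_derivative F (at x) b \<bullet> b)"

text \<open>Weak differentiability at \<open>a\<close> of a parametrised family \<open>g\<close> of densities, with a derivative in
  \<open>L\<^sup>1\<close>, in the sense used for parametrised families of measures (Pflug): the derivative is taken
  against every bounded continuous test function of the state.\<close>

definition weakly_differentiable_at ::
    "('p::euclidean_space \<Rightarrow> 'a::euclidean_space \<Rightarrow> real) \<Rightarrow> 'p \<Rightarrow> bool" where
  "weakly_differentiable_at g a \<longleftrightarrow> (\<exists>D :: 'a \<Rightarrow> 'p. integrable lborel D \<and>
     (\<forall>\<phi>. continuous_on UNIV \<phi> \<and> bounded (range \<phi>) \<longrightarrow>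
        (GDERIV (\<lambda>b. \<integral>x. \<phi> x * g b x \<partial>lborel) a :> (\<integral>x. \<phi> x *\<^sub>R D x \<partial>lborel))))"

definition marginal ::
    "('x::euclidean_space \<times> 'y::euclidean_space \<Rightarrow> real) \<Rightarrow> 'x \<Rightarrow> real" where
  "marginal g X = (\<integral>Y. g (X, Y) \<partial>lborel)"

text \<open>The arguments are ordered parameter, time, state throughout: \<open>R a t q\<close>, \<open>\<Phi> a t q\<close> and
  \<open>f a t Q\<close> stand for \<open>R(q,t;a)\<close>, \<open>\<Phi>\<^sub>t(q;a)\<close> and \<open>f(Q,t|a)\<close>. States are pairs of an observed and a
  latent component. Nothing is assumed of these functions for parameters outside \<open>A\<close> or times
  outside \<open>{0..T}\<close>.\<close>

locale liouville_setting =
  fixes T :: real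
    and A :: "(real ^ 'p) set"
    and R :: "real ^ 'p \<Rightarrow> real \<Rightarrow> (real ^ 'x) \<times> (real ^ 'y) \<Rightarrow> (real ^ 'x) \<times> (real ^ 'y)"
    and f0 :: "(real ^ 'x) \<times> (real ^ 'y) \<Rightarrow> real"
    and \<Omega> :: "((real ^ 'x) \<times> (real ^ 'y)) set"
    and \<Phi> :: "real ^ 'p \<Rightarrow> real \<Rightarrow> (real ^ 'x) \<times> (real ^ 'y) \<Rightarrow> (real ^ 'x) \<times> (real ^ 'y)"
    and f :: "real ^ 'p \<Rightarrow> real \<Rightarrow> (real ^ 'x) \<times> (real ^ 'y) \<Rightarrow> real"
  assumes open_A: "open A"
    and R_C1: "C1_on (UNIV \<times> {0..T} \<times> A) (\<lambda>(q, t, a). R a t q)"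
    and R_Lipschitz: "\<exists>L. \<forall>a\<in>A. \<forall>t\<in>{0..T}. L-lipschitz_on UNIV (R a t)"
    and L_R_finite: "bdd_above {onorm (frechet_derivative (R a t) (at q)) | q t a. t \<in> {0..T} \<and> a \<in> A}"
    and h_C1: "\<And>t. t \<in> {0..T} \<Longrightarrow> C1_on (UNIV \<times> A) (\<lambda>(q, a). divergence (R a t) q)"
    and h_grad_param_bounded: "\<And>B. bounded B \<Longrightarrow>
      bounded {gradient (\<lambda>b. divergence (R b t) q) a | q t a. q \<in> B \<and> t \<in> {0..T} \<and> a \<in> A}"
    and h_grad_state_bounded: "\<And>B. bounded B \<Longrightarrow>
      bounded {gradient (divergence (R a t)) q | q t a. q \<in> B \<and> t \<in> {0..T} \<and> a \<in> A}"
    and f0_measurable: "f0 \<in> borel_measurable borel"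
    and f0_nonneg: "\<And>q. 0 \<le> f0 q"
    and f0_prob: "prob_space (density lborel f0)"
    and f0_support: "\<Omega> = closure {q. f0 q \<noteq> 0}"
    and f0_C1: "C1_on (interior \<Omega>) f0"
    and f0_pos: "\<And>q. q \<in> interior \<Omega> \<Longrightarrow> 0 < f0 q"
    and interior_full: "AE q in density lborel f0. q \<in> interior \<Omega>"
    and f0_score: "(\<integral>\<^sup>+q\<in>interior \<Omega>. ennreal ((norm (gradient (\<lambda>x. ln (f0 x)) q))\<^sup>2)
                      \<partial>density lborel f0) < \<infinity>"
    and flow_init: "\<And>a q. a \<in> A \<Longrightarrow> \<Phi> a 0 q = q"
    and flow_ode: "\<And>a q t. a \<in> A \<Longrightarrow> t \<in> {0..T} \<Longrightarrow>
      ((\<lambda>s. \<Phi> a s q) has_vector_derivative R a t (\<Phi> a t q)) (at t within {0..T})"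
    and flow_diffeo: "\<And>a t. a \<in> A \<Longrightarrow> t \<in> {0..T} \<Longrightarrow>
      bij (\<Phi> a t) \<and> C1_on UNIV (\<Phi> a t) \<and> C1_on UNIV (inv (\<Phi> a t))"
    and f_nonneg: "\<And>a t Q. a \<in> A \<Longrightarrow> t \<in> {0..T} \<Longrightarrow> 0 \<le> f a t Q"
    and f_density: "\<And>a t. a \<in> A \<Longrightarrow> t \<in> {0..T} \<Longrightarrow>
      distr (density lborel f0) borel (\<Phi> a t) = density lborel (f a t)"
    and f_C1: "\<And>a. a \<in> A \<Longrightarrow> C1_on (UNIV \<times> {0..T}) (\<lambda>(Q, t). f a t Q)"
    and f_init: "\<And>a Q. a \<in> A \<Longrightarrow> f a 0 Q = f0 Q"
    and f_Liouville: "\<And>a t Q. a \<in> A \<Longrightarrow> t \<in> {0..T} \<Longrightarrow>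
      ((\<lambda>s. f a s Q) has_real_derivative - divergence (\<lambda>q. f a t q *\<^sub>R R a t q) Q) (at t within {0..T})"
    and log_f_differentiable: "\<And>a Q. a \<in> A \<Longrightarrow> inv (\<Phi> a T) Q \<in> interior \<Omega> \<Longrightarrow>
      (\<lambda>b. ln (f b T Q)) differentiable (at a)"
    and marginal_weakly_differentiable: "\<And>a t. a \<in> A \<Longrightarrow> t \<in> {0..T} \<Longrightarrow>
      weakly_differentiable_at (\<lambda>b. marginal (f b t)) a"

text \<open>The Eulerian sensitivity \<open>G(Q,T;a)\<close>. Its value \<open>0\<close> at states that are not reached from
  \<open>interior \<Omega>\<close> is a convention and concerns only a null set of initial states.\<close>

definition sensitivity ::
    "'a::euclidean_space set \<Rightarrow> ('p::euclidean_space \<Rightarrow> real \<Rightarrow> 'a \<Rightarrow> 'a) \<Rightarrow> ('p \<Rightarrow> real \<Rightarrow> 'a \<Rightarrow> real)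
      \<Rightarrow> real \<Rightarrow> 'p \<Rightarrow> 'a \<Rightarrow> 'p" where
  "sensitivity \<Omega> \<Phi> f T a Q =
     (if inv (\<Phi> a T) Q \<in> interior \<Omega> then gradient (\<lambda>b. ln (f b T Q)) a else 0)"

definition weak_moment :: "('x::euclidean_space \<Rightarrow> real) \<Rightarrow> ('x \<Rightarrow> real) \<Rightarrow> real" where
  "weak_moment \<phi> g = (\<integral>X. \<phi> X * g X \<partial>lborel)"

definition weak_loss ::
    "nat \<Rightarrow> (nat \<Rightarrow> 'x::euclidean_space \<Rightarrow> real) \<Rightarrow> ('x \<Rightarrow> real) \<Rightarrow> ('x \<Rightarrow> real) \<Rightarrow> real" where
  "weak_loss K \<phi> g_obs g = 1/2 * (\<Sum>k=1..K. (weak_moment (\<phi> k) g_obs - weak_moment (\<phi> k) g)\<^sup>2)"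

text \<open>The argument \<open>q\<close> is the sample of terminal states, \<open>G\<close> the sensitivity, \<open>m\<close> the observed
  moments.\<close>

definition crossed_estimator ::
    "nat \<Rightarrow> nat \<Rightarrow> (nat \<Rightarrow> 'x::euclidean_space \<Rightarrow> real) \<Rightarrow> (nat \<Rightarrow> real)
      \<Rightarrow> ('x \<times> 'y::euclidean_space \<Rightarrow> 'p::euclidean_space) \<Rightarrow> (nat \<Rightarrow> 'x \<times> 'y) \<Rightarrow> 'p" where
  "crossed_estimator K N \<phi> m G q =
     (\<Sum>k=1..K. (1 / (real N * (real N - 1))) *\<^sub>R
        (\<Sum>i=1..N. \<Sum>j\<in>{1..N} - {i}.
           ((\<phi> k (fst (q i)) - m k) * \<phi> k (fst (q j))) *\<^sub>R G (q j)))"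

text \<open>In the theorem, weak differentiability is also required of the joint density at the terminal
  time. For the marginal alone it does not suffice when \<open>\<Omega>\<close> is unbounded. Take independent \<open>X\<close>, \<open>Y\<close>,
  with \<open>X\<close> Gaussian and \<open>Y\<close> Cauchy, and the field \<open>R(X,Y,t;a) = (v(Y,a),0)\<close> with
  \<open>v(Y,a) = a (\<Sum>n. \<chi>\<^sub>n(\<bar>a\<bar>) A\<^sub>n b(Y - n))\<close> for \<open>a \<noteq> 0\<close>, \<open>v(Y,0) = 0\<close>; here \<open>b\<close> is a smooth bump
  supported in \<open>(-1/2,1/2)\<close>, \<open>\<chi>\<^sub>n\<close> a smooth dyadic partition of unity near \<open>0\<close>, \<open>\<chi>\<^sub>n\<close> living on
  \<open>\<bar>a\<bar> \<approx> 2\<^sup>-\<^sup>n\<close>, and \<open>A\<^sub>n \<approx> n\<^sup>2\<close> normalised by \<open>E[A\<^sub>n b(Y - n)] = 1\<close>. Then \<open>E[v(Y,a)] = a\<close>, so the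
  marginal has derivative \<open>-T f\<^sub>X'\<close> at \<open>a = 0\<close>, whereas for each fixed \<open>(X,Y)\<close> the joint density does
  not depend on \<open>a\<close> near \<open>0\<close>: the sensitivity vanishes identically at \<open>a = 0\<close>, the gradient of the
  loss in general does not. With unbounded \<open>\<Omega>\<close> the sensitivity can also fail to be integrable.\<close>

end

theory Submission
  imports Defs
begin

text \<open>Each moment is \<open>\<mu>\<^sub>k(a) = \<integral> \<phi>\<^sub>k(X) f(Q,T|a) dQ\<close> with \<open>Q = (X,Y)\<close>, and the estimator is unbiased once
  \<open>\<partial>\<mu>\<^sub>k = E[\<phi>\<^sub>k G]\<close> is known: for \<open>i \<noteq> j\<close> the samples are independent, so every summand of the crossed
  sum has expectation \<open>(\<mu>\<^sub>k - m\<^sub>k) \<partial>\<mu>\<^sub>k\<close>, where \<open>m\<^sub>k\<close> is the observed moment, and this is the \<open>k\<close>-th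
  term of the gradient of the loss (lemma \<open>crossed_sum_unbiased\<close>).

  Weak differentiability of the joint density provides an integrable \<open>D\<close> with
  \<open>\<partial>\<mu>\<^sub>k = \<integral> \<phi>\<^sub>k D\<close>. The work lies in identifying \<open>D\<close> with the pointwise derivative \<open>\<partial>f = f G\<close> almost
  everywhere (lemma \<open>weak_derivative_eq_sensitivity\<close>), which also makes \<open>\<phi>\<^sub>k G\<close> integrable. Against
  compactly supported test functions this is dominated convergence, and the difference quotients of
  \<open>f\<close> in the parameter must be bounded locally uniformly in \<open>Q\<close>. This bound is lemma
  \<open>parameter_Lipschitz\<close>: along the trajectory that ends at \<open>Q\<close>, the Liouville equation is the linear
  equation \<open>g' = - (div R) g\<close>, and Gronwall's inequality, applied backwards in time to the
  trajectories and then forwards to the densities along them, compares two nearby parameters.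

  The pointwise derivative is \<open>f G\<close> also where \<open>G\<close> is \<open>0\<close> by convention (lemma \<open>density_GDERIV\<close>):
  at states not reached from the interior of \<open>\<Omega>\<close> the density vanishes, the initial density is \<open>C\<^sup>1\<close> on
  the whole space and minimal at the corresponding initial state, hence has gradient \<open>0\<close> there, and
  \<open>f\<close> is at most a constant times the initial density transported by the flow.\<close>

section \<open>Gronwall estimate\<close>

text \<open>The squared norm is differentiable where the norm is not. With \<open>2 \<bar>u\<bar> e \<le> \<bar>u\<bar>\<^sup>2 + e\<^sup>2\<close> it satisfies
  \<open>(\<bar>u\<bar>\<^sup>2)' \<le> (2 L + 1) \<bar>u\<bar>\<^sup>2 + e\<^sup>2\<close>.\<close>

lemma gronwall_norm_forward:
  fixes u :: "real \<Rightarrow> 'a::euclidean_space"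
  assumes der: "\<And>s. s \<in> {0..T} \<Longrightarrow> (u has_vector_derivative u' s) (at s within {0..T})"
    and bound: "\<And>s. s \<in> {0..T} \<Longrightarrow> norm (u' s) \<le> L * norm (u s) + e"
    and L: "0 \<le> L" and e: "0 \<le> e" and s: "s \<in> {0..T}"
  shows "(norm (u s))\<^sup>2 \<le> exp ((2*L+1) * T) * ((norm (u 0))\<^sup>2 + e\<^sup>2 * T)"
proof -
  define M where "M = 2*L+1"
  define w where "w = (\<lambda>r. (u r \<bullet> u r) * exp (- M * r) - e\<^sup>2 * r)"
  have T: "0 \<le> T" "0 \<le> s" "s \<le> T" using s by auto
  have M: "0 \<le> M" using L by (simp add: M_def)
  have cont_u: "continuous_on {0..T} u"
    using der by (meson continuous_on_eq_continuous_within has_vector_derivative_continuous)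
  have "w s \<le> w 0"
  proof (rule DERIV_nonpos_imp_decreasing_open[OF \<open>0 \<le> s\<close>])
    show "continuous_on {0..s} w" unfolding w_def using T
      by (intro continuous_intros continuous_on_subset[OF cont_u]) auto
    fix r assume r: "0 < r" "r < s"
    have "(u has_vector_derivative u' r) (at r)"
      using der[of r] r T by (simp add: at_within_Icc_at)
    then have "((\<lambda>x. u x \<bullet> u x) has_real_derivative (u r \<bullet> u' r + u' r \<bullet> u r)) (at r)"
      unfolding has_vector_derivative_def has_field_derivative_def
      by (auto intro!: derivative_eq_intros simp: inner_commute algebra_simps)
    then have d: "(w has_real_derivative
        ((u r \<bullet> u' r + u' r \<bullet> u r) * exp (- M * r) + (u r \<bullet> u r) * (exp (- M * r) * (- M)) - e\<^sup>2)) (at r)"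
      unfolding w_def by (auto intro!: derivative_eq_intros simp: algebra_simps)
    have "u r \<bullet> u' r \<le> norm (u r) * norm (u' r)" by (rule norm_cauchy_schwarz)
    also have "\<dots> \<le> norm (u r) * (L * norm (u r) + e)"
      using bound[of r] r T by (intro mult_left_mono) auto
    finally have "2 * (u r \<bullet> u' r) \<le> 2 * L * (norm (u r))\<^sup>2 + 2 * norm (u r) * e"
      by (simp add: algebra_simps power2_eq_square)
    also have "\<dots> \<le> M * (norm (u r))\<^sup>2 + e\<^sup>2"
      using sum_squares_bound[of "norm (u r)" e] unfolding M_def by (simp add: algebra_simps)
    finally have "(2 * (u r \<bullet> u' r) - M * (u r \<bullet> u r)) * exp (- M * r) \<le> e\<^sup>2 * exp (- M * r)"
      by (intro mult_right_mono) (auto simp: power2_norm_eq_inner)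
    also have "\<dots> \<le> e\<^sup>2 * 1" using M r by (intro mult_left_mono) auto
    finally show "\<exists>y. (w has_real_derivative y) (at r) \<and> y \<le> 0"
      using d by (intro exI[of _ "(u r \<bullet> u' r + u' r \<bullet> u r) * exp (- M * r)
          + (u r \<bullet> u r) * (exp (- M * r) * (- M)) - e\<^sup>2"]) (simp add: algebra_simps inner_commute)
  qed
  then have "(norm (u s))\<^sup>2 * exp (- M * s) \<le> (norm (u 0))\<^sup>2 + e\<^sup>2 * s"
    by (simp add: w_def power2_norm_eq_inner)
  also have "\<dots> \<le> (norm (u 0))\<^sup>2 + e\<^sup>2 * T" using T by (simp add: mult_left_mono)
  finally have "(norm (u s))\<^sup>2 * exp (- M * s) * exp (M * s) \<le> ((norm (u 0))\<^sup>2 + e\<^sup>2 * T) * exp (M * s)"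
    by (rule mult_right_mono) simp
  then have "(norm (u s))\<^sup>2 \<le> ((norm (u 0))\<^sup>2 + e\<^sup>2 * T) * exp (M * s)"
    by (simp add: mult.assoc flip: exp_add)
  also have "\<dots> \<le> ((norm (u 0))\<^sup>2 + e\<^sup>2 * T) * exp (M * T)"
    using T M by (intro mult_left_mono) (auto simp: mult_left_mono)
  finally show ?thesis by (simp add: M_def mult.commute)
qed

lemma gronwall_norm_backward:
  fixes u :: "real \<Rightarrow> 'a::euclidean_space"
  assumes der: "\<And>s. s \<in> {0..T} \<Longrightarrow> (u has_vector_derivative u' s) (at s within {0..T})"
    and bound: "\<And>s. s \<in> {0..T} \<Longrightarrow> norm (u' s) \<le> L * norm (u s) + e"
    and L: "0 \<le> L" and e: "0 \<le> e" and s: "s \<in> {0..T}"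
  shows "(norm (u s))\<^sup>2 \<le> exp ((2*L+1) * T) * ((norm (u T))\<^sup>2 + e\<^sup>2 * T)"
proof -
  \<comment> \<open>Time reversal reduces the claim to the forward estimate.\<close>
  have img: "(\<lambda>x. T - x) ` {0..T} = {0..T}"
  proof -
    have "x \<in> (\<lambda>x. T - x) ` {0..T}" if "x \<in> {0..T}" for x
      by (rule image_eqI[of _ _ "T - x"]) (use that in auto)
    then show ?thesis by auto
  qed
  have "((\<lambda>x. u (T - x)) has_vector_derivative - u' (T - r)) (at r within {0..T})"
    if r: "r \<in> {0..T}" for r
  proof -
    have "(u has_vector_derivative u' (T - r)) (at (T - r) within (\<lambda>x. T - x) ` {0..T})"
      unfolding img using der[of "T - r"] r by auto
    moreover have "((\<lambda>x. T - x) has_vector_derivative - 1) (at r within {0..T})"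
      by (auto intro!: derivative_eq_intros)
    ultimately show ?thesis
      using vector_diff_chain_within[of "\<lambda>x. T - x" "-1" r "{0..T}" u "u' (T - r)"] by (simp add: o_def)
  qed
  from gronwall_norm_forward[of T "\<lambda>x. u (T - x)" "\<lambda>x. - u' (T - x)" L e "T - s", OF this]
  show ?thesis using bound L e s by auto
qed

text \<open>A constant \<open>c\<close> for which \<open>\<bar>u' s\<bar> \<le> L \<bar>u s\<bar> + e\<close> on \<open>{0..T}\<close> implies \<open>\<bar>u s\<bar> \<le> c (\<bar>u s\<^sub>0\<bar> + e)\<close>, where
  \<open>s\<^sub>0\<close> is either end of the interval; it is not optimal.\<close>

definition gronwall_const :: "real \<Rightarrow> real \<Rightarrow> real" where
  "gronwall_const L T = sqrt (exp ((2*L+1) * T) * (1 + T))"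

lemma gronwall_const_nonneg: "0 \<le> T \<Longrightarrow> 0 \<le> gronwall_const L T"
  by (simp add: gronwall_const_def)

lemma gronwall_const_bound:
  assumes "x\<^sup>2 \<le> exp ((2*L+1) * T) * (a\<^sup>2 + e\<^sup>2 * T)" "0 \<le> a" "0 \<le> e" "0 \<le> (T::real)"
  shows "x \<le> gronwall_const L T * (a + e)"
proof -
  have "a\<^sup>2 + e\<^sup>2 * T \<le> (1 + T) * (a + e)\<^sup>2"
    using assms by (simp add: power2_eq_square algebra_simps)
  then have "exp ((2*L+1) * T) * (a\<^sup>2 + e\<^sup>2 * T) \<le> exp ((2*L+1) * T) * ((1 + T) * (a + e)\<^sup>2)"
    by (intro mult_left_mono) auto
  then have "x\<^sup>2 \<le> exp ((2*L+1) * T) * (1 + T) * (a + e)\<^sup>2"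
    using order_trans[OF assms(1)] by (simp only: mult.assoc)
  then have "x \<le> sqrt (exp ((2*L+1) * T) * (1 + T) * (a + e)\<^sup>2)" by (rule real_le_rsqrt)
  then show ?thesis using assms by (simp add: gronwall_const_def real_sqrt_mult)
qed

lemma
  fixes u :: "real \<Rightarrow> 'a::euclidean_space"
  assumes "\<And>s. s \<in> {0..T} \<Longrightarrow> (u has_vector_derivative u' s) (at s within {0..T})"
    and "\<And>s. s \<in> {0..T} \<Longrightarrow> norm (u' s) \<le> L * norm (u s) + e"
    and "0 \<le> L" and "0 \<le> e" and "s \<in> {0..T}"
  shows gronwall_forward: "norm (u s) \<le> gronwall_const L T * (norm (u 0) + e)"
    and gronwall_backward: "norm (u s) \<le> gronwall_const L T * (norm (u T) + e)"
  using gronwall_norm_forward[OF assms] gronwall_norm_backward[OF assms] assms(4,5)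
  by (auto intro: gronwall_const_bound)

section \<open>Continuously differentiable functions and gradients\<close>

lemma C1_on_imp_continuous_on: "C1_on S F \<Longrightarrow> continuous_on S F"
  unfolding C1_on_def by (meson continuous_on_eq_continuous_within has_derivative_continuous)

lemma C1_on_Lipschitz_compact_convex:
  assumes "C1_on S F" "compact K" "convex K" "K \<subseteq> S"
  shows "\<exists>C\<ge>0. \<forall>x\<in>K. \<forall>y\<in>K. norm (F x - F y) \<le> C * norm (x - y)"
proof -
  obtain F' where F': "\<And>x. x \<in> S \<Longrightarrow> (F has_derivative blinfun_apply (F' x)) (at x within S)"
    "continuous_on S F'" using assms(1) unfolding C1_on_def by blast
  have "bounded (F' ` K)"
    using assms F'(2) by (intro compact_imp_bounded compact_continuous_image) (auto intro: continuous_on_subset)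
  then obtain C where C: "C > 0" "\<And>x. x \<in> K \<Longrightarrow> norm (F' x) \<le> C"
    unfolding bounded_pos by auto
  have "norm (F x - F y) \<le> C * norm (x - y)" if "x \<in> K" "y \<in> K" for x y
  proof (rule differentiable_bound[OF \<open>convex K\<close> _ _ that])
    fix z assume "z \<in> K"
    then show "(F has_derivative blinfun_apply (F' z)) (at z within K)"
      using F'(1)[of z] assms(4) by (auto intro: has_derivative_subset)
    show "onorm (blinfun_apply (F' z)) \<le> C"
      using C(2)[OF \<open>z \<in> K\<close>] by (simp add: norm_blinfun.rep_eq)
  qed
  then show ?thesis using C(1) by (intro exI[of _ C]) auto
qed

lemma GDERIV_unique: "GDERIV F x :> D \<Longrightarrow> GDERIV F x :> E \<Longrightarrow> D = (E::'a::euclidean_space)"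
  unfolding gderiv_def
  by (metis has_derivative_unique inner_commute vector_eq_ldot)

lemma GDERIV_imp_gradient: "GDERIV F x :> D \<Longrightarrow> gradient F x = D"
  unfolding gradient_def using GDERIV_unique by blast

lemma differentiable_imp_GDERIV:
  fixes F :: "'a::euclidean_space \<Rightarrow> real"
  assumes "F differentiable (at x)"
  shows "GDERIV F x :> gradient F x"
proof -
  obtain F' where F': "(F has_derivative F') (at x)" using assms unfolding differentiable_def by blast
  interpret F': bounded_linear F' using F' by (rule has_derivative_bounded_linear)
  define D where "D = (\<Sum>b\<in>Basis. F' b *\<^sub>R b)"
  have "F' h = h \<bullet> D" for h
  proof -
    have "F' h = F' (\<Sum>b\<in>Basis. (h \<bullet> b) *\<^sub>R b)" by (simp add: euclidean_representation)
    also have "\<dots> = h \<bullet> D" by (simp add: F'.sum F'.scaleR D_def inner_sum_right mult.commute)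
    finally show ?thesis .
  qed
  then have "F' = (\<lambda>h. h \<bullet> D)" by auto
  then have "GDERIV F x :> D" using F' by (simp add: gderiv_def)
  then show ?thesis using GDERIV_imp_gradient by metis
qed

lemma GDERIV_imp_differentiable: "GDERIV F x :> D \<Longrightarrow> F differentiable (at x)"
  unfolding gderiv_def differentiable_def by blast

lemma bounded_gradient_imp_Lipschitz:
  fixes F :: "'a::euclidean_space \<Rightarrow> real"
  assumes "convex S" and "\<And>x. x \<in> S \<Longrightarrow> F differentiable (at x)"
    and bd: "\<And>x. x \<in> S \<Longrightarrow> norm (gradient F x) \<le> C" and "x \<in> S" "y \<in> S"
  shows "\<bar>F x - F y\<bar> \<le> C * norm (x - y)"
proof -
  have "norm (F x - F y) \<le> C * norm (x - y)"
  proof (rule differentiable_bound[OF \<open>convex S\<close> _ _ \<open>x \<in> S\<close> \<open>y \<in> S\<close>])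
    fix z assume z: "z \<in> S"
    show "(F has_derivative (\<lambda>h. h \<bullet> gradient F z)) (at z within S)"
      using differentiable_imp_GDERIV[OF assms(2)[OF z]] unfolding gderiv_def
      by (rule has_derivative_at_withinI)
    have "norm (h \<bullet> gradient F z) \<le> C * norm h" for h
      using Cauchy_Schwarz_ineq2[of h "gradient F z"] bd[OF z]
      by (smt (verit) mult.commute mult_left_mono norm_ge_zero real_norm_def)
    then show "onorm (\<lambda>h. h \<bullet> gradient F z) \<le> C" by (rule onorm_le)
  qed
  then show ?thesis by simp
qed

text \<open>\<open>I\<close> is arbitrary, so the frozen variables may range over a closed time interval.\<close>

lemma C1_on_slice:
  fixes F :: "'a::euclidean_space \<times> 'b::euclidean_space \<Rightarrow> 'c::euclidean_space"
  assumes "C1_on (UNIV \<times> I) F" "t \<in> I"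
  shows "C1_on UNIV (\<lambda>q. F (q, t))"
proof -
  obtain F' where F': "\<And>x. x \<in> UNIV \<times> I \<Longrightarrow> (F has_derivative blinfun_apply (F' x)) (at x within UNIV \<times> I)"
    "continuous_on (UNIV \<times> I) F'" using assms(1) unfolding C1_on_def by blast
  define J where "J = Blinfun (\<lambda>q::'a. (q, 0::'b))"
  have J: "blinfun_apply J = (\<lambda>q. (q, 0))"
    unfolding J_def by (rule bounded_linear_Blinfun_apply) (intro bounded_linear_Pair bounded_linear_ident bounded_linear_zero)
  have "((\<lambda>q. F (q, t)) has_derivative blinfun_apply (F' (q, t) o\<^sub>L J)) (at q)" for q
  proof -
    have "((\<lambda>q. F (q, t)) has_derivative (\<lambda>h. blinfun_apply (F' (q, t)) (h, 0))) (at q)"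
    proof (rule has_derivative_in_compose[where f="\<lambda>q. (q, t)"])
      show "((\<lambda>q. (q, t)) has_derivative (\<lambda>h. (h, 0))) (at q)"
        by (auto intro!: derivative_eq_intros)
      show "(F has_derivative blinfun_apply (F' (q, t))) (at (q, t) within range (\<lambda>q. (q, t)))"
        using F'(1)[of "(q, t)"] assms(2) by (auto intro: has_derivative_subset)
    qed
    moreover have "blinfun_apply (F' (q, t) o\<^sub>L J) = (\<lambda>h. blinfun_apply (F' (q, t)) (h, 0))"
      by (auto simp: J)
    ultimately show ?thesis by simp
  qed
  moreover have "continuous_on UNIV (\<lambda>q. F' (q, t) o\<^sub>L J)"
    using assms(2)
    by (intro bounded_bilinear.continuous_on[OF bounded_bilinear_blinfun_compose]
        continuous_on_compose2[OF F'(2)] continuous_intros) auto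
  ultimately show ?thesis unfolding C1_on_def by (intro exI[of _ "\<lambda>q. F' (q, t) o\<^sub>L J"]) auto
qed

lemma C1_on_UNIV_imp_differentiable: "C1_on UNIV F \<Longrightarrow> F differentiable (at x)"
  unfolding C1_on_def differentiable_def by blast

lemma GDERIV_imp_directional_limit:
  assumes "GDERIV F a :> D" "s \<longlonglongrightarrow> 0" "\<And>n. s n \<noteq> 0"
  shows "(\<lambda>n. (F (a + s n *\<^sub>R v) - F a) / s n) \<longlonglongrightarrow> D \<bullet> v"
proof -
  have "((\<lambda>t. F (a + t *\<^sub>R v)) has_derivative (\<lambda>t. (t *\<^sub>R v) \<bullet> D)) (at 0)"
    by (rule has_derivative_compose[where f="\<lambda>t. a + t *\<^sub>R v" and g=F])
      (use assms(1) in \<open>auto simp: gderiv_def intro!: derivative_eq_intros\<close>)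
  then have "((\<lambda>t. F (a + t *\<^sub>R v)) has_real_derivative D \<bullet> v) (at 0)"
    by (simp add: has_field_derivative_def inner_commute mult.commute[of _ "D \<bullet> v"] mult_commute_abs)
  then have "((\<lambda>h. (F (a + h *\<^sub>R v) - F a) / h) \<longlongrightarrow> D \<bullet> v) (at 0)"
    by (simp add: DERIV_def)
  then show ?thesis using assms(2,3)
    by (auto simp: tendsto_at_iff_sequentially o_def)
qed

section \<open>The fundamental lemma of the calculus of variations\<close>

lemma AE_zero_of_open_integrals:
  fixes g :: "'a::euclidean_space \<Rightarrow> real"
  assumes int: "integrable lborel g"
    and zero: "\<And>V. open V \<Longrightarrow> (\<integral>x. indicator V x * g x \<partial>lborel) = 0"
  shows "AE x in lborel. g x = 0"
proof -
  have m[measurable]: "g \<in> borel_measurable borel" using int by simp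
  define p where "p = density lborel (\<lambda>x. ennreal (g x))"
  define n where "n = density lborel (\<lambda>x. ennreal (- g x))"
  have eqop: "emeasure p V = emeasure n V" if V: "open V" for V
  proof -
    have [measurable]: "V \<in> sets borel" using V by simp
    have i: "integrable lborel (\<lambda>x. indicator V x * g x)"
      using integrable_mult_indicator[OF _ int, of V] by simp
    have "(\<integral>x. max 0 (indicator V x * g x) \<partial>lborel) - (\<integral>x. max 0 (- (indicator V x * g x)) \<partial>lborel)
        = (\<integral>x. max 0 (indicator V x * g x) - max 0 (- (indicator V x * g x)) \<partial>lborel)"
      using i by (intro Bochner_Integration.integral_diff[symmetric]) auto
    also have "\<dots> = (\<integral>x. indicator V x * g x \<partial>lborel)"
      by (rule Bochner_Integration.integral_cong) (auto simp: max_def)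
    finally have "(\<integral>x. max 0 (indicator V x * g x) \<partial>lborel) - (\<integral>x. max 0 (- (indicator V x * g x)) \<partial>lborel)
        = (\<integral>x. indicator V x * g x \<partial>lborel)" .
    then have eq: "(\<integral>x. max 0 (indicator V x * g x) \<partial>lborel) = (\<integral>x. max 0 (- (indicator V x * g x)) \<partial>lborel)"
      using zero[OF V] by simp
    have "emeasure p V = (\<integral>\<^sup>+x. ennreal (max 0 (indicator V x * g x)) \<partial>lborel)"
      unfolding p_def by (subst emeasure_density) (auto intro!: nn_integral_cong split: split_indicator simp: max_def ennreal_neg)
    also have "\<dots> = ennreal (\<integral>x. max 0 (indicator V x * g x) \<partial>lborel)"
      using i by (intro nn_integral_eq_integral) auto
    also have "\<dots> = (\<integral>\<^sup>+x. ennreal (max 0 (- (indicator V x * g x))) \<partial>lborel)"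
      unfolding eq using i by (intro nn_integral_eq_integral[symmetric]) auto
    also have "\<dots> = emeasure n V"
      unfolding n_def by (subst emeasure_density) (auto intro!: nn_integral_cong split: split_indicator simp: max_def ennreal_neg)
    finally show ?thesis .
  qed
  have fin: "emeasure p UNIV \<noteq> \<infinity>"
    using int unfolding p_def real_integrable_def by (subst emeasure_density) auto
  \<comment> \<open>The open sets are an intersection-stable generator and \<open>p\<close>, \<open>n\<close> are finite.\<close>
  have "p = n"
  proof (rule measure_eqI_generator_eq[where E="{V. open V}" and \<Omega>=UNIV and A="\<lambda>_. UNIV"])
    show "Int_stable {V::'a set. open V}" by (auto simp: Int_stable_def)
  qed (use eqop fin in \<open>auto simp: p_def n_def borel_def\<close>)
  then have "AE x in lborel. ennreal (g x) = ennreal (- g x)"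
    unfolding p_def n_def by (intro sigma_finite_measure.density_unique[OF sigma_finite_lborel]) auto
  then show ?thesis
    by eventually_elim (metis ennreal_eq_0_iff ennreal_neg linorder_le_cases neg_0_le_iff_le neg_le_0_iff_le order_antisym)
qed

text \<open>The indicator of a bounded open set \<open>W\<close> is the pointwise limit of the continuous functions
  \<open>min 1 (n dist(x, - W))\<close>, so equal integrals against test functions give equal integrals over bounded
  open sets.\<close>

lemma AE_eq_of_test_functions:
  fixes g h :: "'a::euclidean_space \<Rightarrow> real"
  assumes g: "integrable lborel g" and h: "h \<in> borel_measurable borel"
    and hb: "\<And>r. \<exists>C. \<forall>x. norm x \<le> r \<longrightarrow> \<bar>h x\<bar> \<le> C"
    and test: "\<And>\<phi> r. continuous_on UNIV \<phi> \<Longrightarrow> (\<And>x. \<bar>\<phi> x\<bar> \<le> 1) \<Longrightarrow>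
       (\<And>x. r < norm x \<Longrightarrow> \<phi> x = 0) \<Longrightarrow>
       (\<integral>x. \<phi> x * g x \<partial>lborel) = (\<integral>x. \<phi> x * h x \<partial>lborel)"
  shows "AE x in lborel. g x = h x"
proof -
  note [measurable] = h
  have gm[measurable]: "g \<in> borel_measurable borel" using g by simp
  have loc: "integrable lborel (\<lambda>x. indicator (ball 0 r) x * (g x - h x))" for r :: real
  proof -
    obtain C where C: "\<And>x. norm x \<le> r \<Longrightarrow> \<bar>h x\<bar> \<le> C" using hb by blast
    have "integrable lborel (\<lambda>x. indicator (ball 0 r) x *\<^sub>R h x)"
      by (rule integrableI_bounded_set_indicator[where B=C])
        (use C emeasure_lborel_ball_finite[of "0::'a" r] in \<open>auto simp: less_imp_le less_top[symmetric] intro!: AE_I2\<close>)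
    moreover have "integrable lborel (\<lambda>x. indicator (ball 0 r) x *\<^sub>R g x)"
      using integrable_mult_indicator[OF _ g, of "ball 0 r"] by simp
    ultimately have "integrable lborel (\<lambda>x. indicator (ball 0 r) x *\<^sub>R g x - indicator (ball 0 r) x *\<^sub>R h x)"
      by (intro Bochner_Integration.integrable_diff)
    then show ?thesis by (simp add: algebra_simps)
  qed
  have "AE x in lborel. indicator (ball 0 (real k)) x * (g x - h x) = 0" for k :: nat
  proof (rule AE_zero_of_open_integrals[OF loc])
    fix V :: "'a set" assume V: "open V"
    define W where "W = V \<inter> ball 0 (real k)"
    have W: "open W" unfolding W_def using V by auto
    have [measurable]: "W \<in> sets borel" using W by simp
    \<comment> \<open>The case \<open>W = UNIV\<close> is separate because \<open>infdist\<close> to the empty set is \<open>0\<close>.\<close>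
    define \<phi> where "\<phi> = (\<lambda>n x. if W = UNIV then (1::real) else min 1 (real n * infdist x (- W)))"
    have \<phi>c: "continuous_on UNIV (\<phi> n)" for n
      unfolding \<phi>_def by (cases "W = UNIV") (auto intro!: continuous_intros)
    have \<phi>1: "\<bar>\<phi> n x\<bar> \<le> 1" "0 \<le> \<phi> n x" for n x
      unfolding \<phi>_def using infdist_nonneg[of x "- W"] by auto
    have \<phi>0: "\<phi> n x = 0" if "x \<notin> W" for n x
      using that unfolding \<phi>_def by auto
    have lim: "(\<lambda>n. \<phi> n x) \<longlonglongrightarrow> indicator W x" for x
    proof (cases "x \<in> W \<and> W \<noteq> UNIV")
      case True
      then have "infdist x (- W) > 0"
        using in_closed_iff_infdist_zero[of "- W" x] W infdist_nonneg[of x "- W"]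
        by (auto simp: closed_def less_le)
      then obtain N where N: "1 < real N * infdist x (- W)" using reals_Archimedean3 by blast
      have "\<forall>\<^sub>F n in sequentially. \<phi> n x = 1"
        using eventually_ge_at_top[of N]
      proof eventually_elim
        case (elim n)
        then have "real N * infdist x (- W) \<le> real n * infdist x (- W)"
          by (intro mult_right_mono) (auto simp: infdist_nonneg)
        then show ?case using N True by (auto simp: \<phi>_def)
      qed
      then show ?thesis using True by (auto intro: tendsto_eventually)
    next
      case False
      then have "\<phi> n x = indicator W x" for n
        using \<phi>0[of x n] by (cases "x \<in> W") (auto simp: \<phi>_def)
      then show ?thesis by simp
    qed
    have conv: "(\<lambda>n. \<integral>x. \<phi> n x * (g x - h x) \<partial>lborel) \<longlonglongrightarrow> (\<integral>x. indicator W x * (g x - h x) \<partial>lborel)"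
    proof (rule integral_dominated_convergence[where w="\<lambda>x. \<bar>indicator (ball 0 (real k)) x * (g x - h x)\<bar>"])
      show "integrable lborel (\<lambda>x. \<bar>indicator (ball 0 (real k)) x * (g x - h x)\<bar>)" using loc by auto
      show "(\<lambda>x. \<phi> n x * (g x - h x)) \<in> borel_measurable lborel" for n
        using borel_measurable_continuous_onI[OF \<phi>c[of n]] by measurable
      show "AE x in lborel. (\<lambda>n. \<phi> n x * (g x - h x)) \<longlonglongrightarrow> indicator W x * (g x - h x)"
        using lim by (auto intro!: AE_I2 tendsto_intros)
      show "AE x in lborel. norm (\<phi> n x * (g x - h x)) \<le> \<bar>indicator (ball 0 (real k)) x * (g x - h x)\<bar>" for n
      proof (rule AE_I2)
        fix x
        show "norm (\<phi> n x * (g x - h x)) \<le> \<bar>indicator (ball 0 (real k)) x * (g x - h x)\<bar>"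
          using \<phi>1(1)[of n x] \<phi>0[of x n] mult_right_mono[OF \<phi>1(1)[of n x], of "\<bar>g x - h x\<bar>"]
          by (cases "x \<in> W") (auto simp: W_def abs_mult)
      qed
    qed simp
    have "(\<integral>x. \<phi> n x * (g x - h x) \<partial>lborel) = 0" for n
    proof -
      note [measurable] = borel_measurable_continuous_onI[OF \<phi>c[of n]]
      have ig: "integrable lborel (\<lambda>x. \<phi> n x * g x)"
        by (rule Bochner_Integration.integrable_bound[OF g])
          (use mult_right_mono[OF \<phi>1(1)] in \<open>auto intro!: AE_I2 simp: abs_mult\<close>)
      have i: "integrable lborel (\<lambda>x. \<phi> n x * (g x - h x))"
      proof (rule Bochner_Integration.integrable_bound[OF loc[of "real k"]])
        show "AE x in lborel. norm (\<phi> n x * (g x - h x)) \<le> norm (indicator (ball 0 (real k)) x * (g x - h x))"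
        proof (rule AE_I2)
          fix x
          show "norm (\<phi> n x * (g x - h x)) \<le> norm (indicator (ball 0 (real k)) x * (g x - h x))"
            using \<phi>1(1)[of n x] \<phi>0[of x n] mult_right_mono[OF \<phi>1(1)[of n x], of "\<bar>g x - h x\<bar>"]
            by (cases "x \<in> W") (auto simp: W_def abs_mult)
        qed
      qed measurable
      have ih: "integrable lborel (\<lambda>x. \<phi> n x * h x)"
        using Bochner_Integration.integrable_diff[OF ig i] by (simp add: algebra_simps)
      have "(\<integral>x. \<phi> n x * g x \<partial>lborel) = (\<integral>x. \<phi> n x * h x \<partial>lborel)"
        by (rule test[of _ "real k", OF \<phi>c \<phi>1(1)]) (auto intro!: \<phi>0 simp: W_def)
      then show ?thesis using ig ih by (simp add: right_diff_distrib)
    qed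
    then have "(\<integral>x. indicator W x * (g x - h x) \<partial>lborel) = 0"
      using conv by (simp add: LIMSEQ_const_iff)
    then show "(\<integral>x. indicator V x * (indicator (ball 0 (real k)) x * (g x - h x)) \<partial>lborel) = 0"
      by (simp add: W_def indicator_inter_arith mult.assoc)
  qed
  then have "AE x in lborel. \<forall>k::nat. indicator (ball 0 (real k)) x * (g x - h x) = 0"
    by (subst AE_all_countable) auto
  then show ?thesis
  proof eventually_elim
    case (elim x)
    obtain k :: nat where "norm x < real k" using reals_Archimedean2 by blast
    then show ?case using elim[rule_format, of k] by auto
  qed
qed

section \<open>The density along characteristics\<close>

context liouville_setting
begin

lemma state_slice_differentiable:
  assumes "a \<in> A" "t \<in> {0..T}"
  shows "R a t differentiable (at q)" "f a t differentiable (at q)"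
    "divergence (R a t) differentiable (at q)"
proof -
  show "R a t differentiable (at q)"
    using C1_on_slice[OF R_C1, of "(t, a)"] assms
      C1_on_UNIV_imp_differentiable[of "R a t"] by simp
  show "f a t differentiable (at q)"
    using C1_on_slice[OF f_C1, of a t] assms C1_on_UNIV_imp_differentiable[of "f a t"] by simp
  show "divergence (R a t) differentiable (at q)"
    using C1_on_slice[OF h_C1, of t a] assms C1_on_UNIV_imp_differentiable[of "divergence (R a t)"] by simp
qed

lemma divergence_param_differentiable:
  assumes "a \<in> A" "t \<in> {0..T}"
  shows "(\<lambda>b. divergence (R b t) q) differentiable (at a)"
proof -
  obtain F' where *: "\<And>x. x \<in> UNIV \<times> A \<Longrightarrow>
      ((\<lambda>(q, a). divergence (R a t) q) has_derivative blinfun_apply (F' x)) (at x within UNIV \<times> A)"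
    using h_C1[OF assms(2)] unfolding C1_on_def by blast
  then have F': "((\<lambda>(q, a). divergence (R a t) q) has_derivative blinfun_apply (F' (q, a))) (at (q, a))"
    using *[of "(q, a)"] assms(1) open_A at_within_open[of "(q, a)" "UNIV \<times> A"] by (simp add: open_Times)
  have "((\<lambda>b. (q, b)) has_derivative (\<lambda>h. (0, h))) (at a)"
    by (auto intro!: derivative_eq_intros)
  from has_derivative_compose[OF this F'] show ?thesis
    unfolding differentiable_def by auto
qed

lemma R_Lipschitz_nonneg:
  "\<exists>L\<ge>0. \<forall>a\<in>A. \<forall>t\<in>{0..T}. \<forall>q q'. norm (R a t q - R a t q') \<le> L * norm (q - q')"
proof -
  obtain L where L: "\<And>a t. a \<in> A \<Longrightarrow> t \<in> {0..T} \<Longrightarrow> L-lipschitz_on UNIV (R a t)"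
    using R_Lipschitz by blast
  have "norm (R a t q - R a t q') \<le> max L 0 * norm (q - q')" if "a \<in> A" "t \<in> {0..T}" for a t q q'
  proof -
    have "norm (R a t q - R a t q') \<le> L * norm (q - q')"
      using lipschitz_onD[OF L[OF that], of q q'] by (simp add: dist_norm)
    also have "\<dots> \<le> max L 0 * norm (q - q')" by (intro mult_right_mono) auto
    finally show ?thesis .
  qed
  then show ?thesis by (intro exI[of _ "max L 0"]) auto
qed

lemma divergence_bounded:
  "\<exists>H\<ge>0. \<forall>a\<in>A. \<forall>t\<in>{0..T}. \<forall>q. \<bar>divergence (R a t) q\<bar> \<le> H"
proof -
  obtain B where B: "\<And>a t q. a \<in> A \<Longrightarrow> t \<in> {0..T} \<Longrightarrow> onorm (frechet_derivative (R a t) (at q)) \<le> B"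
    using L_R_finite unfolding bdd_above_def by blast
  have "\<bar>divergence (R a t) q\<bar> \<le> real (card (Basis :: ((real ^ 'x) \<times> (real ^ 'y)) set)) * max B 0"
    if at: "a \<in> A" "t \<in> {0..T}" for a t q
  proof -
    let ?D = "frechet_derivative (R a t) (at q)"
    have bl: "bounded_linear ?D"
      using state_slice_differentiable(1)[OF at] unfolding frechet_derivative_works by (rule has_derivative_bounded_linear)
    have "\<bar>?D b \<bullet> b\<bar> \<le> max B 0" if b: "b \<in> Basis" for b
    proof -
      have "\<bar>?D b \<bullet> b\<bar> \<le> norm (?D b) * norm b" by (rule Cauchy_Schwarz_ineq2)
      also have "\<dots> \<le> onorm ?D * norm b * norm b"
        using onorm[OF bl, of b] by (intro mult_right_mono) auto
      also have "\<dots> \<le> max B 0" using B[OF at, of q] b by auto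
      finally show ?thesis .
    qed
    then have "(\<Sum>b\<in>Basis. \<bar>?D b \<bullet> b\<bar>) \<le> real (card (Basis :: ((real ^ 'x) \<times> (real ^ 'y)) set)) * max B 0"
      by (rule sum_bounded_above)
    then show ?thesis unfolding divergence_def by (rule order_trans[OF sum_abs])
  qed
  then show ?thesis
    by (intro exI[of _ "real (card (Basis :: ((real ^ 'x) \<times> (real ^ 'y)) set)) * max B 0"]) auto
qed

text \<open>Along a trajectory of the flow the Liouville equation is the linear ordinary differential
  equation \<open>g' = - (div R) g\<close>.\<close>

lemma density_along_flow:
  assumes a: "a \<in> A" and T: "0 < T" and t: "t \<in> {0..T}"
  shows "((\<lambda>s. f a s (\<Phi> a s q)) has_vector_derivative
      (- divergence (R a t) (\<Phi> a t q) * f a t (\<Phi> a t q))) (at t within {0..T})"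
proof -
  \<comment> \<open>The chain rule gives \<open>\<partial>\<^sub>t f + \<nabla>f \<bullet> R\<close>; by the product rule \<open>\<nabla>f \<bullet> R\<close> is the part of \<open>div (f R)\<close> other
    than \<open>f div R\<close>.\<close>
  define Q where "Q = \<Phi> a t q"
  obtain F' where "\<And>x. x \<in> UNIV \<times> {0..T} \<Longrightarrow>
      ((\<lambda>(Q, t). f a t Q) has_derivative blinfun_apply (F' x)) (at x within UNIV \<times> {0..T})"
    using f_C1[OF a] unfolding C1_on_def by blast
  then have F': "((\<lambda>(Q, t). f a t Q) has_derivative blinfun_apply (F' (Q, t))) (at (Q, t) within UNIV \<times> {0..T})"
    using t by auto
  let ?F = "blinfun_apply (F' (Q, t))"
  have state: "(f a t has_derivative (\<lambda>h. ?F (h, 0))) (at Q)"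
  proof -
    have "((\<lambda>q. case (q, t) of (Q, t) \<Rightarrow> f a t Q) has_derivative (\<lambda>h. ?F (h, 0))) (at Q)"
    proof (rule has_derivative_in_compose[where f="\<lambda>q. (q, t)"])
      show "((\<lambda>q. (q, t)) has_derivative (\<lambda>h. (h, 0))) (at Q)"
        by (auto intro!: derivative_eq_intros)
      show "((\<lambda>(Q, t). f a t Q) has_derivative ?F) (at (Q, t) within range (\<lambda>q. (q, t)))"
        using t by (intro has_derivative_subset[OF F']) auto
    qed
    then show ?thesis by simp
  qed
  have time: "((\<lambda>s. f a s Q) has_vector_derivative ?F (0, 1)) (at t within {0..T})"
  proof -
    have "((\<lambda>s. case (Q, s) of (Q, t) \<Rightarrow> f a t Q) has_derivative (\<lambda>h. ?F (0, h))) (at t within {0..T})"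
    proof (rule has_derivative_in_compose[where f="\<lambda>s. (Q, s)"])
      show "((\<lambda>s. (Q, s)) has_derivative (\<lambda>h. (0, h))) (at t within {0..T})"
        by (auto intro!: derivative_eq_intros)
      show "((\<lambda>(Q, t). f a t Q) has_derivative ?F) (at (Q, t) within (\<lambda>s. (Q, s)) ` {0..T})"
        by (intro has_derivative_subset[OF F']) auto
    qed
    moreover have eq: "(\<lambda>h. h *\<^sub>R ?F (0, 1)) = (\<lambda>h. ?F (0, h))"
    proof (rule ext)
      fix h :: real
      have "?F (0, h) = ?F (h *\<^sub>R (0, 1))" by simp
      also have "\<dots> = h *\<^sub>R ?F (0, 1)" by (rule blinfun.scaleR_right)
      finally show "h *\<^sub>R ?F (0, 1) = ?F (0, h)" by (rule sym)
    qed
    ultimately show ?thesis unfolding has_vector_derivative_def eq by simp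
  qed
  obtain R' where R': "(R a t has_derivative R') (at Q)"
    using state_slice_differentiable(1)[OF a t] unfolding differentiable_def by blast
  have "((\<lambda>q. f a t q *\<^sub>R R a t q) has_derivative (\<lambda>h. f a t Q *\<^sub>R R' h + ?F (h, 0) *\<^sub>R R a t Q)) (at Q)"
    by (rule has_derivative_scaleR[OF state R'])
  then have fd: "frechet_derivative (\<lambda>q. f a t q *\<^sub>R R a t q) (at Q)
      = (\<lambda>h. f a t Q *\<^sub>R R' h + ?F (h, 0) *\<^sub>R R a t Q)"
    by (rule frechet_derivative_at[symmetric])
  have lin: "bounded_linear (\<lambda>h. ?F (h, 0))" using state by (rule has_derivative_bounded_linear)
  have "(\<Sum>b\<in>Basis. ?F (b, 0) * (R a t Q \<bullet> b)) = ?F (R a t Q, 0)"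
  proof -
    interpret F: bounded_linear "\<lambda>h. ?F (h, 0)" by (rule lin)
    have "?F (R a t Q, 0) = ?F ((\<Sum>b\<in>Basis. (R a t Q \<bullet> b) *\<^sub>R b), 0)"
      by (simp add: euclidean_representation)
    also have "\<dots> = (\<Sum>b\<in>Basis. ?F (b, 0) * (R a t Q \<bullet> b))"
      unfolding F.sum F.scaleR by (simp add: mult.commute)
    finally show ?thesis by simp
  qed
  then have "divergence (\<lambda>q. f a t q *\<^sub>R R a t q) Q = f a t Q * divergence (R a t) Q + ?F (R a t Q, 0)"
    unfolding divergence_def fd frechet_derivative_at[OF R', symmetric]
    by (simp add: inner_add_left sum.distrib sum_distrib_left)
  moreover have "((\<lambda>s. f a s Q) has_vector_derivative - divergence (\<lambda>q. f a t q *\<^sub>R R a t q) Q) (at t within {0..T})"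
    using f_Liouville[OF a t, of Q] by (simp add: has_real_derivative_iff_has_vector_derivative)
  ultimately have "((\<lambda>s. f a s Q) has_vector_derivative
      - (f a t Q * divergence (R a t) Q + ?F (R a t Q, 0))) (at t within {0..T})" by (simp only:)
  from this have "?F (0, 1) = - (f a t Q * divergence (R a t) Q + ?F (R a t Q, 0))"
    using vector_derivative_unique_within_closed_interval[OF T _ time[folded cbox_interval]] t
    unfolding cbox_interval by metis
  moreover have "x = - (u * v + y) \<Longrightarrow> y + x = - v * u" for x y u v :: real
    by (simp add: algebra_simps)
  ultimately have Fsum: "?F (R a t Q, 0) + ?F (0, 1) = - divergence (R a t) Q * f a t Q"
    by blast
  have "((\<lambda>s. (\<Phi> a s q, s)) has_derivative (\<lambda>h. (h *\<^sub>R R a t Q, h))) (at t within {0..T})"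
    using flow_ode[OF a t, of q] unfolding Q_def has_vector_derivative_def
    by (auto intro!: derivative_eq_intros)
  moreover have "((\<lambda>(Q, t). f a t Q) has_derivative ?F) (at (\<Phi> a t q, t) within (\<lambda>s. (\<Phi> a s q, s)) ` {0..T})"
    unfolding Q_def[symmetric] by (rule has_derivative_subset[OF F']) auto
  ultimately have "((\<lambda>s. case (\<Phi> a s q, s) of (Q, t) \<Rightarrow> f a t Q) has_derivative (\<lambda>h. ?F (h *\<^sub>R R a t Q, h))) (at t within {0..T})"
    by (rule has_derivative_in_compose[where f="\<lambda>s. (\<Phi> a s q, s)"])
  moreover have eq: "(\<lambda>h. h *\<^sub>R (?F (R a t Q, 0) + ?F (0, 1))) = (\<lambda>h. ?F (h *\<^sub>R R a t Q, h))"
  proof (rule ext)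
    fix h :: real
    have "?F (h *\<^sub>R R a t Q, h) = ?F (h *\<^sub>R ((R a t Q, 0) + (0, 1)))" by simp
    also have "\<dots> = h *\<^sub>R ?F ((R a t Q, 0) + (0, 1))" by (rule blinfun.scaleR_right)
    also have "\<dots> = h *\<^sub>R (?F (R a t Q, 0) + ?F (0, 1))" by (simp only: blinfun.add_right)
    finally show "h *\<^sub>R (?F (R a t Q, 0) + ?F (0, 1)) = ?F (h *\<^sub>R R a t Q, h)" by (rule sym)
  qed
  ultimately show ?thesis
    unfolding has_vector_derivative_def Q_def[symmetric] Fsum[symmetric] eq by simp
qed

lemma initial_density_C1:
  assumes "a \<in> A" "0 < T" shows "C1_on UNIV f0"
proof -
  have "f a 0 = f0" using f_init[OF assms(1)] by auto
  then show ?thesis using C1_on_slice[OF f_C1[OF assms(1)], of 0] assms by simp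
qed

lemma flow_measurable:
  assumes "a \<in> A" "t \<in> {0..T}" shows "\<Phi> a t \<in> borel_measurable borel"
  using flow_diffeo[OF assms] C1_on_imp_continuous_on by (intro borel_measurable_continuous_onI) blast

text \<open>An open set on which the density is nonzero lies in the interior of its support. Hence the
  density vanishes on the whole boundary of \<open>\<Omega>\<close>, not just almost everywhere.\<close>

lemma f0_eq_0_iff:
  assumes "a \<in> A" "0 < T"
  shows "f0 q = 0 \<longleftrightarrow> q \<notin> interior \<Omega>"
proof
  assume "f0 q = 0" then show "q \<notin> interior \<Omega>" using f0_pos[of q] by auto
next
  assume q: "q \<notin> interior \<Omega>"
  show "f0 q = 0"
  proof (rule ccontr)
    assume nz: "f0 q \<noteq> 0"
    have "open {q. f0 q \<noteq> 0}"
      using C1_on_imp_continuous_on[OF initial_density_C1[OF assms]] by (auto intro!: open_Collect_neq continuous_on_const)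
    moreover have "{q. f0 q \<noteq> 0} \<subseteq> \<Omega>" unfolding f0_support by (rule closure_subset)
    ultimately have "q \<in> interior \<Omega>" using nz by (intro interiorI[of "{q. f0 q \<noteq> 0}"]) auto
    then show False using q by simp
  qed
qed

text \<open>The trajectory that is at \<open>Q\<close> at the terminal time.\<close>

definition trajectory_to where
  "trajectory_to Q a s = \<Phi> a s (inv (\<Phi> a T) Q)"

lemma trajectory_to_terminal:
  assumes "a \<in> A" "0 < T" shows "trajectory_to Q a T = Q"
proof -
  have "bij (\<Phi> a T)" using flow_diffeo[of a T] assms by auto
  then show ?thesis unfolding trajectory_to_def by (simp add: bij_is_surj surj_f_inv_f)
qed

lemma trajectory_to_initial: "a \<in> A \<Longrightarrow> trajectory_to Q a 0 = inv (\<Phi> a T) Q"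
  by (simp add: trajectory_to_def flow_init)

lemma trajectory_to_ode:
  assumes "a \<in> A" "s \<in> {0..T}"
  shows "(trajectory_to Q a has_vector_derivative R a s (trajectory_to Q a s)) (at s within {0..T})"
  using flow_ode[OF assms] unfolding trajectory_to_def by simp

lemma density_along_trajectory_to:
  assumes "a \<in> A" "0 < T" "s \<in> {0..T}"
  shows "((\<lambda>s. f a s (trajectory_to Q a s)) has_vector_derivative
      - divergence (R a s) (trajectory_to Q a s) * f a s (trajectory_to Q a s)) (at s within {0..T})"
  using density_along_flow[OF assms] unfolding trajectory_to_def by simp

text \<open>Transport changes the density only by a factor between two positive constants.\<close>

lemma density_comparable_initial:
  assumes a: "a \<in> A" and T: "0 < T" and H0: "0 \<le> H"
    and H: "\<And>t q. t \<in> {0..T} \<Longrightarrow> \<bar>divergence (R a t) q\<bar> \<le> H" and s: "s \<in> {0..T}"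
  shows "\<bar>f a s (trajectory_to Q a s)\<bar> \<le> gronwall_const H T * \<bar>f0 (trajectory_to Q a 0)\<bar>"
    and "\<bar>f0 (trajectory_to Q a 0)\<bar> \<le> gronwall_const H T * \<bar>f a T Q\<bar>"
proof -
  have b: "norm (- divergence (R a t) (trajectory_to Q a t) * f a t (trajectory_to Q a t))
      \<le> H * norm (f a t (trajectory_to Q a t)) + 0" if "t \<in> {0..T}" for t
    using mult_right_mono[OF H[OF that]] by (simp add: abs_mult)
  note d = density_along_trajectory_to[OF a T]
  show "\<bar>f a s (trajectory_to Q a s)\<bar> \<le> gronwall_const H T * \<bar>f0 (trajectory_to Q a 0)\<bar>"
    using gronwall_forward[OF d b H0 _ s] f_init[OF a] by simp
  show "\<bar>f0 (trajectory_to Q a 0)\<bar> \<le> gronwall_const H T * \<bar>f a T Q\<bar>"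
    using gronwall_backward[OF d b H0 order_refl, of 0] f_init[OF a] trajectory_to_terminal[OF a T] T by simp
qed

lemma density_eq_0_iff:
  assumes a: "a \<in> A" and T: "0 < T"
  shows "f a T Q = 0 \<longleftrightarrow> inv (\<Phi> a T) Q \<notin> interior \<Omega>"
proof -
  obtain H where H: "0 \<le> H" "\<And>t q. t \<in> {0..T} \<Longrightarrow> \<bar>divergence (R a t) q\<bar> \<le> H"
    using divergence_bounded a by blast
  have "f a T Q = 0 \<longleftrightarrow> f0 (trajectory_to Q a 0) = 0"
    using density_comparable_initial[OF a T H, of T Q] T trajectory_to_terminal[OF a T] by auto
  then show ?thesis using f0_eq_0_iff[OF a T] trajectory_to_initial[OF a] by simp
qed

lemma density_integrable:
  assumes a: "a \<in> A" and t: "t \<in> {0..T}"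
  shows "integrable lborel (f a t)"
proof -
  have c: "continuous_on UNIV (f a t)"
    using C1_on_imp_continuous_on[OF C1_on_slice[OF f_C1[OF a], of t]] t by simp
  have [measurable]: "f a t \<in> borel_measurable borel" by (rule borel_measurable_continuous_onI[OF c])
  note [measurable] = flow_measurable[OF a t]
  interpret prob_space "density lborel f0" by (rule f0_prob)
  interpret D: prob_space "distr (density lborel f0) borel (\<Phi> a t)" by (rule prob_space_distr) simp
  have "emeasure (density lborel (f a t)) UNIV = 1"
    using D.emeasure_space_1 unfolding f_density[OF a t] by simp
  then have "(\<integral>\<^sup>+x. ennreal (f a t x) \<partial>lborel) = 1" by (simp add: emeasure_density)
  then show ?thesis using f_nonneg[OF a t] by (intro integrableI_nonneg) auto
qed

end

section \<open>Dependence of the density on the parameter\<close>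

context liouville_setting
begin

text \<open>The initial state of the trajectory that ends at \<open>Q\<close>, and the terminal density at \<open>Q\<close>, are Lipschitz
  continuous in the parameter, locally uniformly in \<open>Q\<close>. The radius \<open>\<delta>\<close> of the parameter ball does not
  depend on the bound \<open>r\<close> for the states.\<close>

lemma parameter_Lipschitz:
  assumes \<alpha>: "\<alpha> \<in> A" and T: "0 < T"
  obtains \<delta> where "0 < \<delta>" "cball \<alpha> \<delta> \<subseteq> A"
    "\<And>r. \<exists>C\<ge>0. \<forall>b\<in>cball \<alpha> \<delta>. \<forall>Q. norm Q \<le> r \<longrightarrow>
       norm (trajectory_to Q b 0 - trajectory_to Q \<alpha> 0) \<le> C * norm (b - \<alpha>) \<and>
       \<bar>f b T Q - f \<alpha> T Q\<bar> \<le> C * norm (b - \<alpha>)"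
proof -
  obtain \<delta> where \<delta>: "0 < \<delta>" "cball \<alpha> \<delta> \<subseteq> A" using open_A \<alpha> open_contains_cball by blast
  define B where "B = cball \<alpha> \<delta>"
  have B: "\<alpha> \<in> B" "compact B" "convex B" "\<And>b. b \<in> B \<Longrightarrow> b \<in> A" using \<delta> by (auto simp: B_def)
  obtain L where L0: "0 \<le> L"
    and L: "\<And>a t q q'. a \<in> A \<Longrightarrow> t \<in> {0..T} \<Longrightarrow> norm (R a t q - R a t q') \<le> L * norm (q - q')"
    using R_Lipschitz_nonneg by blast
  obtain H where H0: "0 \<le> H" and H: "\<And>a t q. a \<in> A \<Longrightarrow> t \<in> {0..T} \<Longrightarrow> \<bar>divergence (R a t) q\<bar> \<le> H"
    using divergence_bounded by blast
  define cL cH where "cL = gronwall_const L T" and "cH = gronwall_const H T"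
  have c0: "0 \<le> cL" "0 \<le> cH" using T gronwall_const_nonneg[of T] by (auto simp: cL_def cH_def)
  have "compact ((\<lambda>(q, t, a). R a t q) ` ({0} \<times> {0..T} \<times> B))"
    by (intro compact_continuous_image continuous_on_subset[OF C1_on_imp_continuous_on[OF R_C1]]
        compact_Times B) (use B in auto)
  then have "bounded ((\<lambda>(q, t, a). R a t q) ` ({0} \<times> {0..T} \<times> B))" by (rule compact_imp_bounded)
  then obtain E where E0: "0 < E" and E: "\<And>b s. b \<in> B \<Longrightarrow> s \<in> {0..T} \<Longrightarrow> norm (R b s 0) \<le> E"
    unfolding bounded_pos by (auto simp: image_iff)
  have "\<exists>C\<ge>0. \<forall>b\<in>cball \<alpha> \<delta>. \<forall>Q. norm Q \<le> r \<longrightarrow>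
       norm (trajectory_to Q b 0 - trajectory_to Q \<alpha> 0) \<le> C * norm (b - \<alpha>) \<and>
       \<bar>f b T Q - f \<alpha> T Q\<bar> \<le> C * norm (b - \<alpha>)" for r
  proof -
    \<comment> \<open>By linear growth of the field, all trajectories concerned stay in one ball, on whose compact
      product with times and parameters the derivatives of the field are bounded.\<close>
    define \<rho> where "\<rho> = cL * (r + E)"
    have stay: "trajectory_to Q b s \<in> cball 0 \<rho>"
      if "b \<in> B" "norm Q \<le> r" "s \<in> {0..T}" for b Q s
    proof -
      have bd: "norm (R b t (trajectory_to Q b t)) \<le> L * norm (trajectory_to Q b t) + E" if t: "t \<in> {0..T}" for t
        using L[OF B(4)[OF \<open>b \<in> B\<close>] t, of "trajectory_to Q b t" 0] E[OF \<open>b \<in> B\<close> t]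
          norm_triangle_sub[of "R b t (trajectory_to Q b t)" "R b t 0"] by simp
      have "norm (trajectory_to Q b s) \<le> cL * (norm (trajectory_to Q b T) + E)"
        unfolding cL_def
        by (rule gronwall_backward[OF trajectory_to_ode[OF B(4)[OF \<open>b \<in> B\<close>]] bd L0])
          (use E0 that in auto)
      also have "\<dots> \<le> \<rho>" unfolding \<rho>_def trajectory_to_terminal[OF B(4)[OF \<open>b \<in> B\<close>] T]
        using that c0 by (intro mult_left_mono) auto
      finally show ?thesis by simp
    qed
    obtain CR where CR0: "0 \<le> CR" and CR: "\<And>x y. x \<in> cball 0 \<rho> \<times> {0..T} \<times> B \<Longrightarrow> y \<in> cball 0 \<rho> \<times> {0..T} \<times> B \<Longrightarrow>
        norm ((\<lambda>(q, t, a). R a t q) x - (\<lambda>(q, t, a). R a t q) y) \<le> CR * norm (x - y)"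
    proof -
      let ?K = "(cball 0 \<rho> :: ((real ^ 'x) \<times> (real ^ 'y)) set) \<times> {0..T} \<times> B"
      have "compact ?K" "convex ?K" "?K \<subseteq> UNIV \<times> {0..T} \<times> A"
        using B by (auto intro!: compact_Times convex_Times compact_cball convex_cball)
      from C1_on_Lipschitz_compact_convex[OF R_C1 this] show ?thesis using that by blast
    qed
    have CR': "norm (R b s q - R \<alpha> s q) \<le> CR * norm (b - \<alpha>)"
      if "b \<in> B" "s \<in> {0..T}" "q \<in> cball 0 \<rho>" for b s q
      using CR[of "(q, s, b)" "(q, s, \<alpha>)"] that B(1) by (simp add: norm_Pair)
    define C1 where "C1 = cL * CR"
    have C1_nn: "0 \<le> C1" using c0 CR0 by (simp add: C1_def)
    have traj: "norm (trajectory_to Q b s - trajectory_to Q \<alpha> s) \<le> C1 * norm (b - \<alpha>)"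
      if b: "b \<in> B" and Q: "norm Q \<le> r" and s: "s \<in> {0..T}" for b Q s
    proof -
      have d: "((\<lambda>t. trajectory_to Q b t - trajectory_to Q \<alpha> t) has_vector_derivative
          (R b t (trajectory_to Q b t) - R \<alpha> t (trajectory_to Q \<alpha> t))) (at t within {0..T})"
        if "t \<in> {0..T}" for t
        using that B b \<alpha> by (intro has_vector_derivative_diff trajectory_to_ode) auto
      have bd: "norm (R b t (trajectory_to Q b t) - R \<alpha> t (trajectory_to Q \<alpha> t))
          \<le> L * norm (trajectory_to Q b t - trajectory_to Q \<alpha> t) + CR * norm (b - \<alpha>)"
        if t: "t \<in> {0..T}" for t
        using norm_triangle_ineq[of "R b t (trajectory_to Q b t) - R b t (trajectory_to Q \<alpha> t)"
            "R b t (trajectory_to Q \<alpha> t) - R \<alpha> t (trajectory_to Q \<alpha> t)"]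
          L[OF B(4)[OF b] t, of "trajectory_to Q b t" "trajectory_to Q \<alpha> t"]
          CR'[OF b t stay[OF B(1) Q t]] by simp
      have "norm (trajectory_to Q b s - trajectory_to Q \<alpha> s)
          \<le> cL * (norm (trajectory_to Q b T - trajectory_to Q \<alpha> T) + CR * norm (b - \<alpha>))"
        unfolding cL_def by (rule gronwall_backward[OF d bd L0]) (use s CR0 in auto)
      then show ?thesis using trajectory_to_terminal[OF B(4)[OF b] T] trajectory_to_terminal[OF \<alpha> T]
        by (simp add: C1_def)
    qed
    obtain Cp where Cp: "\<And>q t a. q \<in> cball 0 \<rho> \<Longrightarrow> t \<in> {0..T} \<Longrightarrow> a \<in> A \<Longrightarrow>
        norm (gradient (\<lambda>b. divergence (R b t) q) a) \<le> Cp"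
      using h_grad_param_bounded[OF bounded_cball, of 0 \<rho>] unfolding bounded_iff by blast
    obtain Cq where Cq: "\<And>q t a. q \<in> cball 0 \<rho> \<Longrightarrow> t \<in> {0..T} \<Longrightarrow> a \<in> A \<Longrightarrow>
        norm (gradient (divergence (R a t)) q) \<le> Cq"
      using h_grad_state_bounded[OF bounded_cball, of 0 \<rho>] unfolding bounded_iff by blast
    define Ch where "Ch = \<bar>Cp\<bar> + \<bar>Cq\<bar> * C1"
    have Ch0: "0 \<le> Ch" using C1_nn by (simp add: Ch_def)
    have div: "\<bar>divergence (R b s) (trajectory_to Q b s) - divergence (R \<alpha> s) (trajectory_to Q \<alpha> s)\<bar>
        \<le> Ch * norm (b - \<alpha>)" if b: "b \<in> B" and Q: "norm Q \<le> r" and s: "s \<in> {0..T}" for b Q s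
    proof -
      let ?q = "trajectory_to Q b s" and ?q' = "trajectory_to Q \<alpha> s"
      have q: "?q \<in> cball 0 \<rho>" "?q' \<in> cball 0 \<rho>" using stay b B(1) Q s by auto
      have "\<bar>divergence (R b s) ?q - divergence (R \<alpha> s) ?q\<bar> \<le> Cp * norm (b - \<alpha>)"
        using B b s q Cp
        by (intro bounded_gradient_imp_Lipschitz[where F="\<lambda>b. divergence (R b s) ?q" and S=B]
            divergence_param_differentiable) auto
      also have "\<dots> \<le> \<bar>Cp\<bar> * norm (b - \<alpha>)" by (intro mult_right_mono) auto
      finally have 1: "\<bar>divergence (R b s) ?q - divergence (R \<alpha> s) ?q\<bar> \<le> \<bar>Cp\<bar> * norm (b - \<alpha>)" .
      have "\<bar>divergence (R \<alpha> s) ?q - divergence (R \<alpha> s) ?q'\<bar> \<le> Cq * norm (?q - ?q')"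
        using \<alpha> s q Cq
        by (intro bounded_gradient_imp_Lipschitz[where S="cball 0 \<rho>"] state_slice_differentiable) auto
      also have "\<dots> \<le> \<bar>Cq\<bar> * (C1 * norm (b - \<alpha>))"
        using traj[OF b Q s] by (intro mult_mono) auto
      finally have 2: "\<bar>divergence (R \<alpha> s) ?q - divergence (R \<alpha> s) ?q'\<bar> \<le> \<bar>Cq\<bar> * (C1 * norm (b - \<alpha>))" .
      show ?thesis using 1 2 unfolding Ch_def by (simp add: algebra_simps)
    qed
    note f0C1 = initial_density_C1[OF \<alpha> T]
    obtain C0 where C00: "0 \<le> C0" and C0: "\<And>x y. x \<in> cball 0 \<rho> \<Longrightarrow> y \<in> cball 0 \<rho> \<Longrightarrow> norm (f0 x - f0 y) \<le> C0 * norm (x - y)"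
      using C1_on_Lipschitz_compact_convex[OF f0C1 compact_cball convex_cball subset_UNIV] by blast
    have "bounded (f0 ` cball 0 \<rho>)"
      by (intro compact_imp_bounded compact_continuous_image
          continuous_on_subset[OF C1_on_imp_continuous_on[OF f0C1]]) auto
    then obtain F0 where F0: "0 < F0" "\<And>q. q \<in> cball 0 \<rho> \<Longrightarrow> \<bar>f0 q\<bar> \<le> F0"
      unfolding bounded_pos by auto
    define G0 where "G0 = cH * F0"
    have G0nn: "0 \<le> G0" using c0 F0 by (simp add: G0_def)
    define C2 where "C2 = cH * (C0 * C1 + Ch * G0)"
    have C2nn: "0 \<le> C2" using c0 C00 C1_nn Ch0 G0nn by (simp add: C2_def)
    have dens: "\<bar>f b T Q - f \<alpha> T Q\<bar> \<le> C2 * norm (b - \<alpha>)"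
      if b: "b \<in> B" and Q: "norm Q \<le> r" for b Q
    proof -
      let ?g = "\<lambda>a s. f a s (trajectory_to Q a s)" and ?h = "\<lambda>a s. divergence (R a s) (trajectory_to Q a s)"
      have d: "((\<lambda>s. ?g b s - ?g \<alpha> s) has_vector_derivative (- ?h b s * ?g b s - (- ?h \<alpha> s * ?g \<alpha> s))) (at s within {0..T})"
        if "s \<in> {0..T}" for s
        using that B b \<alpha> T by (intro has_vector_derivative_diff density_along_trajectory_to) auto
      have bd: "norm (- ?h b s * ?g b s - (- ?h \<alpha> s * ?g \<alpha> s)) \<le> H * norm (?g b s - ?g \<alpha> s) + Ch * norm (b - \<alpha>) * G0"
        if s: "s \<in> {0..T}" for s
      proof -
        have "\<bar>?g \<alpha> s\<bar> \<le> cH * \<bar>f0 (trajectory_to Q \<alpha> 0)\<bar>"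
          unfolding cH_def by (rule density_comparable_initial(1)[OF \<alpha> T H0 H[OF \<alpha>] s])
        also have "\<dots> \<le> G0" unfolding G0_def
          using F0(2)[OF stay[OF B(1) Q, of 0]] T c0 by (intro mult_left_mono) auto
        finally have g: "\<bar>?g \<alpha> s\<bar> \<le> G0" .
        have split: "\<bar>- h1 * g1 - (- h0 * g0)\<bar> \<le> \<bar>h1\<bar> * \<bar>g1 - g0\<bar> + \<bar>h1 - h0\<bar> * \<bar>g0\<bar>"
          for h1 g1 h0 g0 :: real
        proof -
          have "- h1 * g1 - (- h0 * g0) = - (h1 * (g1 - g0) + (h1 - h0) * g0)"
            by (simp add: algebra_simps)
          then show ?thesis
            using abs_triangle_ineq[of "h1 * (g1 - g0)" "(h1 - h0) * g0"] by (simp only: abs_minus_cancel abs_mult)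
        qed
        have "\<bar>- ?h b s * ?g b s - (- ?h \<alpha> s * ?g \<alpha> s)\<bar>
            \<le> \<bar>?h b s\<bar> * \<bar>?g b s - ?g \<alpha> s\<bar> + \<bar>?h b s - ?h \<alpha> s\<bar> * \<bar>?g \<alpha> s\<bar>" by (rule split)
        also have "\<dots> \<le> H * \<bar>?g b s - ?g \<alpha> s\<bar> + Ch * norm (b - \<alpha>) * G0"
          using H[OF B(4)[OF b] s] div[OF b Q s] g H0 Ch0 by (intro add_mono mult_mono) auto
        finally show ?thesis by simp
      qed
      have "norm (?g b T - ?g \<alpha> T) \<le> cH * (norm (?g b 0 - ?g \<alpha> 0) + Ch * norm (b - \<alpha>) * G0)"
        unfolding cH_def by (rule gronwall_forward[OF d bd H0]) (use T Ch0 G0nn in auto)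
      also have "norm (?g b 0 - ?g \<alpha> 0) \<le> C0 * (C1 * norm (b - \<alpha>))"
      proof -
        have "norm (f0 (trajectory_to Q b 0) - f0 (trajectory_to Q \<alpha> 0)) \<le> C0 * norm (trajectory_to Q b 0 - trajectory_to Q \<alpha> 0)"
          using stay b B(1) Q T by (intro C0) auto
        also have "\<dots> \<le> C0 * (C1 * norm (b - \<alpha>))" using traj[OF b Q, of 0] T C00 by (intro mult_left_mono) auto
        finally show ?thesis using f_init[OF \<alpha>] f_init[OF B(4)[OF b]] by simp
      qed
      finally have "norm (?g b T - ?g \<alpha> T) \<le> cH * (C0 * (C1 * norm (b - \<alpha>)) + Ch * norm (b - \<alpha>) * G0)"
        using c0 by (simp add: mult_left_mono)
      then show ?thesis using trajectory_to_terminal[OF B(4)[OF b] T] trajectory_to_terminal[OF \<alpha> T]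
        by (simp add: C2_def algebra_simps)
    qed
    show ?thesis
    proof (intro exI[of _ "max C1 C2"] conjI ballI allI impI)
      show "0 \<le> max C1 C2" using C1_nn by simp
      fix b Q assume *: "b \<in> cball \<alpha> \<delta>" "norm (Q :: (real ^ 'x) \<times> (real ^ 'y)) \<le> r"
      have m: "C1 * norm (b - \<alpha>) \<le> max C1 C2 * norm (b - \<alpha>)" "C2 * norm (b - \<alpha>) \<le> max C1 C2 * norm (b - \<alpha>)"
        by (auto intro: mult_right_mono)
      show "norm (trajectory_to Q b 0 - trajectory_to Q \<alpha> 0) \<le> max C1 C2 * norm (b - \<alpha>)"
        using traj[of b Q 0] * T m by (auto simp: B_def intro: order_trans)
      show "\<bar>f b T Q - f \<alpha> T Q\<bar> \<le> max C1 C2 * norm (b - \<alpha>)"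
        using dens[of b Q] * m by (auto simp: B_def intro: order_trans)
    qed
  qed
  with that \<delta> show ?thesis by blast
qed

text \<open>The formula holds at every state, also where the sensitivity is \<open>0\<close> by convention.\<close>

lemma density_GDERIV:
  assumes \<alpha>: "\<alpha> \<in> A" and T: "0 < T"
  shows "GDERIV (\<lambda>b. f b T Q) \<alpha> :> f \<alpha> T Q *\<^sub>R sensitivity \<Omega> \<Phi> f T \<alpha> Q"
proof -
  obtain \<delta> where \<delta>: "0 < \<delta>" "cball \<alpha> \<delta> \<subseteq> A"
    and lip: "\<And>r. \<exists>C\<ge>0. \<forall>b\<in>cball \<alpha> \<delta>. \<forall>Q. norm Q \<le> r \<longrightarrow>
       norm (trajectory_to Q b 0 - trajectory_to Q \<alpha> 0) \<le> C * norm (b - \<alpha>) \<and>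
       \<bar>f b T Q - f \<alpha> T Q\<bar> \<le> C * norm (b - \<alpha>)"
    using parameter_Lipschitz[OF \<alpha> T] by metis
  obtain C where C0: "0 \<le> C" and C: "\<forall>b\<in>cball \<alpha> \<delta>. \<forall>Q'. norm Q' \<le> norm Q \<longrightarrow>
       norm (trajectory_to Q' b 0 - trajectory_to Q' \<alpha> 0) \<le> C * norm (b - \<alpha>) \<and>
       \<bar>f b T Q' - f \<alpha> T Q'\<bar> \<le> C * norm (b - \<alpha>)"
    using lip[of "norm Q"] by blast
  have C1: "norm (trajectory_to Q b 0 - trajectory_to Q \<alpha> 0) \<le> C * norm (b - \<alpha>)"
    and C2: "\<bar>f b T Q - f \<alpha> T Q\<bar> \<le> C * norm (b - \<alpha>)" if "b \<in> cball \<alpha> \<delta>" for b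
    using C that by blast+
  show ?thesis
  proof (cases "inv (\<Phi> \<alpha> T) Q \<in> interior \<Omega>")
    case True
    let ?G = "gradient (\<lambda>b. ln (f b T Q)) \<alpha>"
    have pos: "0 < f \<alpha> T Q"
      using density_eq_0_iff[OF \<alpha> T, of Q] True f_nonneg[OF \<alpha>, of T Q] T by simp
    \<comment> \<open>The logarithm of \<open>f\<close> is differentiable, but \<open>f = exp (ln f)\<close> needs \<open>f\<close> to be positive for all
      nearby parameters. This follows from the Lipschitz bound.\<close>
    define \<epsilon> where "\<epsilon> = min \<delta> (f \<alpha> T Q / (C + 1))"
    have \<epsilon>: "0 < \<epsilon>" using \<delta> pos C0 by (simp add: \<epsilon>_def)
    have fpos: "0 < f b T Q" if b: "b \<in> ball \<alpha> \<epsilon>" for b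
    proof -
      have nb: "norm (b - \<alpha>) < \<epsilon>" using b by (simp add: dist_norm norm_minus_commute)
      then have "b \<in> cball \<alpha> \<delta>" by (simp add: \<epsilon>_def dist_norm norm_minus_commute)
      from C2[OF this] have "\<bar>f b T Q - f \<alpha> T Q\<bar> \<le> C * norm (b - \<alpha>)" .
      also have "\<dots> \<le> (C + 1) * norm (b - \<alpha>)" by (intro mult_right_mono) auto
      also have "\<dots> < (C + 1) * (f \<alpha> T Q / (C + 1))"
        using nb C0 by (intro mult_strict_left_mono) (auto simp: \<epsilon>_def)
      also have "\<dots> = f \<alpha> T Q" using C0 by simp
      finally show ?thesis by simp
    qed
    have "GDERIV (\<lambda>b. ln (f b T Q)) \<alpha> :> ?G"
      by (rule differentiable_imp_GDERIV[OF log_f_differentiable[OF \<alpha> True]])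
    from GDERIV_DERIV_compose[OF this DERIV_exp]
    have "GDERIV (\<lambda>b. exp (ln (f b T Q))) \<alpha> :> f \<alpha> T Q *\<^sub>R ?G" using pos by simp
    then have "GDERIV (\<lambda>b. f b T Q) \<alpha> :> f \<alpha> T Q *\<^sub>R ?G"
      unfolding gderiv_def
      by (rule has_derivative_transform_within_open[OF _ open_ball[of \<alpha> \<epsilon>]]) (use \<epsilon> fpos in auto)
    then show ?thesis using True by (simp add: sensitivity_def)
  next
    case False
    have fa0: "f \<alpha> T Q = 0" using density_eq_0_iff[OF \<alpha> T] False by simp
    define q where "q = trajectory_to Q \<alpha> 0"
    have q0: "f0 q = 0" using f0_eq_0_iff[OF \<alpha> T] False trajectory_to_initial[OF \<alpha>] by (simp add: q_def)
    obtain H where H0: "0 \<le> H" and H: "\<And>a t q. a \<in> A \<Longrightarrow> t \<in> {0..T} \<Longrightarrow> \<bar>divergence (R a t) q\<bar> \<le> H"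
      using divergence_bounded by blast
    define c where "c = gronwall_const H T"
    have c0: "0 \<le> c" using T gronwall_const_nonneg by (simp add: c_def)
    have "f0 differentiable (at q)" by (rule C1_on_UNIV_imp_differentiable[OF initial_density_C1[OF \<alpha> T]])
    then obtain D where D: "(f0 has_derivative D) (at q)" unfolding differentiable_def by blast
    \<comment> \<open>\<open>f0\<close> is nonnegative, so its zero \<open>q\<close> is a minimum.\<close>
    have "D = (\<lambda>v. 0)"
      by (rule differential_zero_maxmin[OF _ open_UNIV D]) (use q0 f0_nonneg in auto)
    then have small: "\<exists>d>0. \<forall>y. norm (y - q) < d \<longrightarrow> \<bar>f0 y\<bar> \<le> e * norm (y - q)" if "0 < e" for e
      using D that q0 unfolding has_derivative_at_alt by auto
    have "\<exists>d>0. \<forall>b. norm (b - \<alpha>) < d \<longrightarrow> \<bar>f b T Q\<bar> \<le> e * norm (b - \<alpha>)" if e: "0 < e" for e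
    proof -
      \<comment> \<open>\<open>c\<close> is lost from the terminal to the initial density, \<open>C\<close> from the parameter to the initial
        state.\<close>
      define e' where "e' = e / (c * C + 1)"
      have cC: "0 \<le> c * C" using c0 C0 by simp
      have e': "0 < e'" using e cC by (simp add: e'_def)
      obtain d where d: "0 < d" and fd: "\<And>y. norm (y - q) < d \<Longrightarrow> \<bar>f0 y\<bar> \<le> e' * norm (y - q)"
        using small[OF e'] by blast
      define d' where "d' = min \<delta> (d / (C + 1))"
      have d'0: "0 < d'" using \<delta> d C0 by (simp add: d'_def)
      have "\<bar>f b T Q\<bar> \<le> e * norm (b - \<alpha>)" if b: "norm (b - \<alpha>) < d'" for b
      proof -
        have bB: "b \<in> cball \<alpha> \<delta>" using b by (simp add: d'_def dist_norm norm_minus_commute)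
        then have bA: "b \<in> A" using \<delta> by auto
        let ?y = "trajectory_to Q b 0"
        have y: "norm (?y - q) \<le> C * norm (b - \<alpha>)" using C1[OF bB] by (simp add: q_def)
        also have "\<dots> \<le> (C + 1) * norm (b - \<alpha>)" by (intro mult_right_mono) auto
        also have "\<dots> < (C + 1) * (d / (C + 1))"
          using b C0 by (intro mult_strict_left_mono) (auto simp: d'_def)
        also have "\<dots> = d" using C0 by simp
        finally have "norm (?y - q) < d" .
        have "\<bar>f b T Q\<bar> \<le> c * \<bar>f0 ?y\<bar>"
          using density_comparable_initial(1)[OF bA T H0 H[OF bA], of T Q] T trajectory_to_terminal[OF bA T]
          by (simp add: c_def)
        also have "\<dots> \<le> c * (e' * (C * norm (b - \<alpha>)))"
          using fd[OF \<open>norm (?y - q) < d\<close>] y e' c0 by (intro mult_left_mono) (auto intro: order_trans mult_left_mono)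
        also have "\<dots> = (c * C) * e' * norm (b - \<alpha>)" by (simp add: algebra_simps)
        also have "\<dots> \<le> (c * C + 1) * e' * norm (b - \<alpha>)"
          using e' by (intro mult_right_mono) auto
        also have "(c * C + 1) * e' = e" using cC by (simp add: e'_def)
        finally show ?thesis .
      qed
      then show ?thesis using d'0 by blast
    qed
    then have "GDERIV (\<lambda>b. f b T Q) \<alpha> :> 0"
      unfolding gderiv_def has_derivative_at_alt by (simp add: fa0)
    then show ?thesis using fa0 by simp
  qed
qed

text \<open>The weak derivative is the pointwise one. The difference quotients of the density in the
  parameter are bounded on bounded sets of states, so dominated convergence applies against compactly
  supported test functions.\<close>

lemma weak_derivative_eq_sensitivity:
  fixes D :: "(real ^ 'x) \<times> (real ^ 'y) \<Rightarrow> real ^ 'p"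
  assumes \<alpha>: "\<alpha> \<in> A" and T: "0 < T"
    and D: "integrable lborel D"
    and weak: "\<And>\<phi>. continuous_on UNIV \<phi> \<Longrightarrow> bounded (range \<phi>) \<Longrightarrow>
        (GDERIV (\<lambda>b. \<integral>x. \<phi> x * f b T x \<partial>lborel) \<alpha> :> (\<integral>x. \<phi> x *\<^sub>R D x \<partial>lborel))"
  shows "(\<lambda>Q. f \<alpha> T Q *\<^sub>R sensitivity \<Omega> \<Phi> f T \<alpha> Q) \<in> borel_measurable borel"
    and "AE Q in lborel. D Q = f \<alpha> T Q *\<^sub>R sensitivity \<Omega> \<Phi> f T \<alpha> Q"
proof -
  let ?F = "\<lambda>Q. f \<alpha> T Q *\<^sub>R sensitivity \<Omega> \<Phi> f T \<alpha> Q"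
  obtain \<delta> where \<delta>: "0 < \<delta>" "cball \<alpha> \<delta> \<subseteq> A"
    and lip: "\<And>r. \<exists>C\<ge>0. \<forall>b\<in>cball \<alpha> \<delta>. \<forall>Q. norm Q \<le> r \<longrightarrow>
       norm (trajectory_to Q b 0 - trajectory_to Q \<alpha> 0) \<le> C * norm (b - \<alpha>) \<and>
       \<bar>f b T Q - f \<alpha> T Q\<bar> \<le> C * norm (b - \<alpha>)"
    using parameter_Lipschitz[OF \<alpha> T] by metis
  define s where "s = (\<lambda>n. \<delta> / real (Suc n))"
  have s0: "s \<longlonglongrightarrow> 0" unfolding s_def
    by (rule LIMSEQ_Suc) (rule lim_const_over_n)
  have sp: "0 < s n" "s n \<le> \<delta>" "s n \<noteq> 0" for n
    using \<delta>(1) by (auto simp: s_def divide_le_eq)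
  have TT: "T \<in> {0..T}" using T by simp
  have fm[measurable]: "f b T \<in> borel_measurable borel" if "b \<in> A" for b
    using density_integrable[OF that TT] by simp
  define q where "q = (\<lambda>v n Q. (f (\<alpha> + s n *\<^sub>R v) T Q - f \<alpha> T Q) / s n)"
  have in_cball: "\<alpha> + s n *\<^sub>R v \<in> cball \<alpha> \<delta>" if "v \<in> Basis" for v n
    using that sp[of n] by (simp add: dist_norm)
  then have inA: "\<alpha> + s n *\<^sub>R v \<in> A" if "v \<in> Basis" for v n
    using that \<delta>(2) by blast
  have qm: "q v n \<in> borel_measurable borel" if "v \<in> Basis" for v n
    using fm[OF inA[OF that]] fm[OF \<alpha>] unfolding q_def by measurable
  have ql: "(\<lambda>n. q v n Q) \<longlonglongrightarrow> ?F Q \<bullet> v" for v Q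
    unfolding q_def by (rule GDERIV_imp_directional_limit[OF density_GDERIV[OF \<alpha> T] s0 sp(3)])
  have Fv: "(\<lambda>Q. ?F Q \<bullet> v) \<in> borel_measurable borel" if "v \<in> Basis" for v
    by (rule borel_measurable_LIMSEQ_real[OF ql qm[OF that]])
  then show "?F \<in> borel_measurable borel"
    by (subst borel_measurable_euclidean_space) auto
  have qb: "\<exists>C. \<forall>v\<in>Basis. \<forall>n Q. norm Q \<le> r \<longrightarrow> \<bar>q v n Q\<bar> \<le> C" for r
  proof -
    obtain C where C: "\<And>b Q. b \<in> cball \<alpha> \<delta> \<Longrightarrow> norm Q \<le> r \<Longrightarrow> \<bar>f b T Q - f \<alpha> T Q\<bar> \<le> C * norm (b - \<alpha>)"
      using lip[of r] by blast
    have "\<bar>q v n Q\<bar> \<le> C" if "v \<in> Basis" "norm Q \<le> r" for v n Q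
      using C[OF in_cball[OF that(1), of n] that(2)] sp[of n] that(1)
      by (simp add: q_def abs_divide divide_le_eq)
    then show ?thesis by blast
  qed
  have "AE Q in lborel. D Q \<bullet> v = ?F Q \<bullet> v" if v: "v \<in> Basis" for v
  proof (rule AE_eq_of_test_functions)
    show Dv: "integrable lborel (\<lambda>Q. D Q \<bullet> v)" using D by simp
    show "(\<lambda>Q. ?F Q \<bullet> v) \<in> borel_measurable borel" using Fv[OF v] .
    show "\<exists>C. \<forall>Q. norm Q \<le> r \<longrightarrow> \<bar>?F Q \<bullet> v\<bar> \<le> C" for r
    proof -
      obtain C where C: "\<And>n Q. norm Q \<le> r \<Longrightarrow> \<bar>q v n Q\<bar> \<le> C" using qb[of r] v by blast
      have "\<bar>?F Q \<bullet> v\<bar> \<le> C" if "norm Q \<le> r" for Q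
        by (rule tendsto_upperbound[OF tendsto_rabs[OF ql]]) (use C that in auto)
      then show ?thesis by blast
    qed
    fix \<phi> :: "(real ^ 'x) \<times> (real ^ 'y) \<Rightarrow> real" and r :: real
    assume \<phi>: "continuous_on UNIV \<phi>" "\<And>x. \<bar>\<phi> x\<bar> \<le> 1" "\<And>x. r < norm x \<Longrightarrow> \<phi> x = 0"
    have [measurable]: "\<phi> \<in> borel_measurable borel" by (rule borel_measurable_continuous_onI[OF \<phi>(1)])
    have bphi: "bounded (range \<phi>)" using \<phi>(2) by (auto simp: bounded_iff)
    have \<phi>f: "integrable lborel (\<lambda>x. \<phi> x * f b T x)" if "b \<in> A" for b
    proof (rule Bochner_Integration.integrable_bound[OF density_integrable[OF that TT]])
      show "AE x in lborel. norm (\<phi> x * f b T x) \<le> norm (f b T x)"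
        using mult_right_mono[OF \<phi>(2)] by (auto simp: abs_mult)
    qed (use fm[OF that] in measurable)
    have quot: "((\<integral>x. \<phi> x * f (\<alpha> + s n *\<^sub>R v) T x \<partial>lborel) - (\<integral>x. \<phi> x * f \<alpha> T x \<partial>lborel)) / s n
        = (\<integral>x. \<phi> x * q v n x \<partial>lborel)" for n
    proof -
      have "(\<integral>x. \<phi> x * q v n x \<partial>lborel)
          = (\<integral>x. (\<phi> x * f (\<alpha> + s n *\<^sub>R v) T x - \<phi> x * f \<alpha> T x) / s n \<partial>lborel)"
        unfolding q_def by (simp add: right_diff_distrib)
      also have "\<dots> = (\<integral>x. \<phi> x * f (\<alpha> + s n *\<^sub>R v) T x - \<phi> x * f \<alpha> T x \<partial>lborel) / s n"
        by (rule integral_divide_zero)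
      finally show ?thesis
        using \<phi>f[OF inA[OF v, of n]] \<phi>f[OF \<alpha>] by simp
    qed
    have "(\<lambda>n. \<integral>x. \<phi> x * q v n x \<partial>lborel) \<longlonglongrightarrow> (\<integral>x. \<phi> x *\<^sub>R D x \<partial>lborel) \<bullet> v"
      using GDERIV_imp_directional_limit[OF weak[OF \<phi>(1) bphi] s0 sp(3), of v] unfolding quot .
    moreover have "(\<lambda>n. \<integral>x. \<phi> x * q v n x \<partial>lborel) \<longlonglongrightarrow> (\<integral>x. \<phi> x * (?F x \<bullet> v) \<partial>lborel)"
    proof -
      obtain C where C: "\<And>n Q. norm Q \<le> r \<Longrightarrow> \<bar>q v n Q\<bar> \<le> C" using qb[of r] v by blast
      let ?w = "\<lambda>x :: (real ^ 'x) \<times> (real ^ 'y). \<bar>C\<bar> * indicator (cball 0 r) x"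
      show ?thesis
      proof (rule integral_dominated_convergence[where w="?w"])
        show "(\<lambda>x. \<phi> x * q v n x) \<in> borel_measurable lborel" for n
          using qm[OF v, of n] by measurable
        show "(\<lambda>x. \<phi> x * (?F x \<bullet> v)) \<in> borel_measurable lborel"
          using Fv[OF v] by measurable
        show "integrable lborel ?w"
          using emeasure_lborel_cball_finite[of "0::(real ^ 'x) \<times> (real ^ 'y)" r]
          by (intro integrable_mult_right integrable_real_indicator) (auto simp: less_top)
        show "AE x in lborel. (\<lambda>n. \<phi> x * q v n x) \<longlonglongrightarrow> \<phi> x * (?F x \<bullet> v)"
          using ql by (auto intro!: tendsto_mult tendsto_const)
        show "AE x in lborel. norm (\<phi> x * q v n x) \<le> \<bar>C\<bar> * indicator (cball 0 r) x" for n
        proof (rule AE_I2)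
          fix x
          have "\<bar>\<phi> x\<bar> * \<bar>q v n x\<bar> \<le> 1 * \<bar>C\<bar>" if "norm x \<le> r"
            using \<phi>(2)[of x] C[OF that, of n] by (intro mult_mono) auto
          then show "norm (\<phi> x * q v n x) \<le> \<bar>C\<bar> * indicator (cball 0 r) x"
            using \<phi>(3)[of x] by (cases "norm x \<le> r") (auto simp: abs_mult)
        qed
      qed
    qed
    ultimately have "(\<integral>x. \<phi> x *\<^sub>R D x \<partial>lborel) \<bullet> v = (\<integral>x. \<phi> x * (?F x \<bullet> v) \<partial>lborel)"
      by (rule LIMSEQ_unique)
    moreover have "integrable lborel (\<lambda>x. \<phi> x *\<^sub>R D x)"
      by (rule Bochner_Integration.integrable_bound[OF D])
        (use D mult_right_mono[OF \<phi>(2)] in \<open>auto simp: norm_scaleR\<close>)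
    ultimately show "(\<integral>x. \<phi> x * (D x \<bullet> v) \<partial>lborel) = (\<integral>x. \<phi> x * (?F x \<bullet> v) \<partial>lborel)"
      by (simp flip: integral_inner_left)
  qed
  then have "AE Q in lborel. \<forall>v\<in>Basis. D Q \<bullet> v = ?F Q \<bullet> v"
    by (intro AE_finite_allI) auto
  then show "AE Q in lborel. D Q = ?F Q"
    by eventually_elim (rule euclidean_eqI, blast)
qed

end

section \<open>Moments and the terminal sample\<close>

lemma continuous_on_compose_fst: "continuous_on UNIV \<phi> \<Longrightarrow> continuous_on UNIV (\<lambda>Q. \<phi> (fst Q))"
  by (rule continuous_on_compose2[where s=UNIV and f=fst]) (auto intro: continuous_intros)

context liouville_setting
begin

lemma weak_moment_marginal:
  fixes \<phi> :: "real ^ 'x \<Rightarrow> real"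
  assumes a: "a \<in> A" and t: "t \<in> {0..T}"
    and \<phi>: "continuous_on UNIV \<phi>" "bounded (range \<phi>)"
  shows "integrable lborel (\<lambda>Q. \<phi> (fst Q) * f a t Q)"
    and "weak_moment \<phi> (marginal (f a t)) = (\<integral>Q. \<phi> (fst Q) * f a t Q \<partial>lborel)"
proof -
  have [measurable]: "(\<lambda>Q. \<phi> (fst Q)) \<in> borel_measurable (borel :: ((real ^ 'x) \<times> (real ^ 'y)) measure)"
    by (rule borel_measurable_continuous_onI[OF continuous_on_compose_fst[OF \<phi>(1)]])
  obtain B where B: "\<And>x. \<bar>\<phi> x\<bar> \<le> B" using \<phi>(2) by (auto simp: bounded_iff)
  have fi: "integrable lborel (f a t)" by (rule density_integrable[OF a t])
  then have [measurable]: "f a t \<in> borel_measurable borel" by simp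
  show int: "integrable lborel (\<lambda>Q. \<phi> (fst Q) * f a t Q)"
  proof (rule Bochner_Integration.integrable_bound[of _ "\<lambda>Q. B * f a t Q"])
    show "AE Q in lborel. norm (\<phi> (fst Q) * f a t Q) \<le> norm (B * f a t Q)"
    proof (rule AE_I2)
      fix Q :: "(real ^ 'x) \<times> (real ^ 'y)"
      have "\<bar>\<phi> (fst Q)\<bar> \<le> \<bar>B\<bar>" using B[of "fst Q"] by linarith
      then show "norm (\<phi> (fst Q) * f a t Q) \<le> norm (B * f a t Q)"
        by (simp add: abs_mult mult_right_mono)
    qed
  qed (use fi in simp_all)
  have "weak_moment \<phi> (marginal (f a t)) = (\<integral>X. (\<integral>Y. \<phi> (fst (X, Y)) * f a t (X, Y) \<partial>lborel) \<partial>lborel)"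
    unfolding weak_moment_def marginal_def by simp
  also have "\<dots> = (\<integral>Q. \<phi> (fst Q) * f a t Q \<partial>(lborel \<Otimes>\<^sub>M lborel))"
    by (rule lborel_pair.integral_fst') (use int in \<open>simp add: lborel_prod\<close>)
  also have "\<dots> = (\<integral>Q. \<phi> (fst Q) * f a t Q \<partial>lborel)" by (simp add: lborel_prod)
  finally show "weak_moment \<phi> (marginal (f a t)) = (\<integral>Q. \<phi> (fst Q) * f a t Q \<partial>lborel)" .
qed

lemma terminal_state_law:
  fixes g :: "(real ^ 'x) \<times> (real ^ 'y) \<Rightarrow> 'b::{banach, second_countable_topology}"
  assumes a: "a \<in> A" and t: "t \<in> {0..T}" and X: "distributed M lborel X f0"
    and g[measurable]: "g \<in> borel_measurable borel"
  shows "integrable M (\<lambda>\<omega>. g (\<Phi> a t (X \<omega>))) \<longleftrightarrow> integrable lborel (\<lambda>Q. f a t Q *\<^sub>R g Q)"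
    and "(\<integral>\<omega>. g (\<Phi> a t (X \<omega>)) \<partial>M) = (\<integral>Q. f a t Q *\<^sub>R g Q \<partial>lborel)"
proof -
  note [measurable] = flow_measurable[OF a t]
  have Xm[measurable]: "X \<in> measurable M borel" using distributed_measurable[OF X] by simp
  have fm[measurable]: "f a t \<in> borel_measurable borel" using density_integrable[OF a t] by simp
  have "distr M borel (\<lambda>\<omega>. \<Phi> a t (X \<omega>)) = distr (distr M lborel X) borel (\<Phi> a t)"
    by (subst distr_distr) (auto simp: o_def)
  also have "\<dots> = density lborel (f a t)"
    unfolding distributed_distr_eq_density[OF X] by (rule f_density[OF a t])
  finally have law: "distr M borel (\<lambda>\<omega>. \<Phi> a t (X \<omega>)) = density lborel (f a t)" .
  have "integrable M (\<lambda>\<omega>. g (\<Phi> a t (X \<omega>))) \<longleftrightarrow> integrable (distr M borel (\<lambda>\<omega>. \<Phi> a t (X \<omega>))) g"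
    by (rule integrable_distr_eq[symmetric]) measurable
  also have "\<dots> \<longleftrightarrow> integrable lborel (\<lambda>Q. f a t Q *\<^sub>R g Q)"
    unfolding law using f_nonneg[OF a t] by (intro integrable_density) auto
  finally show "integrable M (\<lambda>\<omega>. g (\<Phi> a t (X \<omega>))) \<longleftrightarrow> integrable lborel (\<lambda>Q. f a t Q *\<^sub>R g Q)" .
  have "(\<integral>\<omega>. g (\<Phi> a t (X \<omega>)) \<partial>M) = integral\<^sup>L (distr M borel (\<lambda>\<omega>. \<Phi> a t (X \<omega>))) g"
    by (rule integral_distr[symmetric]) measurable
  also have "\<dots> = (\<integral>Q. f a t Q *\<^sub>R g Q \<partial>lborel)"
    unfolding law using f_nonneg[OF a t] by (intro integral_density) auto
  finally show "(\<integral>\<omega>. g (\<Phi> a t (X \<omega>)) \<partial>M) = (\<integral>Q. f a t Q *\<^sub>R g Q \<partial>lborel)" .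
qed

text \<open>The identity \<open>\<partial>\<mu> = E[\<phi> G]\<close> for a single moment, as an integral against the terminal density.\<close>

lemma weak_moment_GDERIV:
  fixes \<phi> :: "real ^ 'x \<Rightarrow> real"
  assumes \<alpha>: "\<alpha> \<in> A" and T: "0 < T" and weak: "weakly_differentiable_at (\<lambda>a. f a T) \<alpha>"
    and \<phi>: "continuous_on UNIV \<phi>" "bounded (range \<phi>)"
  defines "w \<equiv> \<lambda>Q. \<phi> (fst Q) *\<^sub>R sensitivity \<Omega> \<Phi> f T \<alpha> Q"
  shows "w \<in> borel_measurable borel"
    and "integrable lborel (\<lambda>Q. f \<alpha> T Q *\<^sub>R w Q)"
    and "GDERIV (\<lambda>a. weak_moment \<phi> (marginal (f a T))) \<alpha> :> (\<integral>Q. f \<alpha> T Q *\<^sub>R w Q \<partial>lborel)"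
proof -
  let ?G = "sensitivity \<Omega> \<Phi> f T \<alpha>"
  have TT: "T \<in> {0..T}" using T by simp
  have [measurable]: "f \<alpha> T \<in> borel_measurable borel" using density_integrable[OF \<alpha> TT] by simp
  have [measurable]: "(\<lambda>Q. \<phi> (fst Q)) \<in> borel_measurable (borel :: ((real ^ 'x) \<times> (real ^ 'y)) measure)"
    by (rule borel_measurable_continuous_onI[OF continuous_on_compose_fst[OF \<phi>(1)]])
  obtain D :: "(real ^ 'x) \<times> (real ^ 'y) \<Rightarrow> real ^ 'p" where D: "integrable lborel D"
    and wd: "\<And>\<psi>. continuous_on UNIV \<psi> \<Longrightarrow> bounded (range \<psi>) \<Longrightarrow>
        (GDERIV (\<lambda>b. \<integral>x. \<psi> x * f b T x \<partial>lborel) \<alpha> :> (\<integral>x. \<psi> x *\<^sub>R D x \<partial>lborel))"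
    using weak unfolding weakly_differentiable_at_def by blast
  have fG[measurable]: "(\<lambda>Q. f \<alpha> T Q *\<^sub>R ?G Q) \<in> borel_measurable borel"
    by (rule weak_derivative_eq_sensitivity(1)[OF \<alpha> T D]) (rule wd)
  have DG: "AE Q in lborel. D Q = f \<alpha> T Q *\<^sub>R ?G Q"
    by (rule weak_derivative_eq_sensitivity(2)[OF \<alpha> T D]) (rule wd)
  \<comment> \<open>Where \<open>f \<alpha> T\<close> vanishes, both sides are \<open>0\<close>.\<close>
  have "?G = (\<lambda>Q. (1 / f \<alpha> T Q) *\<^sub>R (f \<alpha> T Q *\<^sub>R ?G Q))"
    using density_eq_0_iff[OF \<alpha> T] by (auto simp: sensitivity_def fun_eq_iff)
  also have "\<dots> \<in> borel_measurable borel" by (rule borel_measurable_scaleR[OF _ fG]) simp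
  finally have [measurable]: "?G \<in> borel_measurable borel" .
  show "w \<in> borel_measurable borel" unfolding w_def by measurable
  obtain B where B: "\<And>x. \<bar>\<phi> x\<bar> \<le> B" using \<phi>(2) by (auto simp: bounded_iff)
  have Dm[measurable]: "D \<in> borel_measurable borel" using D by simp
  have int: "integrable lborel (\<lambda>Q. \<phi> (fst Q) *\<^sub>R D Q)"
  proof (rule Bochner_Integration.integrable_bound[of _ "\<lambda>Q. B *\<^sub>R D Q"])
    show "AE Q in lborel. norm (\<phi> (fst Q) *\<^sub>R D Q) \<le> norm (B *\<^sub>R D Q)"
    proof (rule AE_I2)
      fix Q :: "(real ^ 'x) \<times> (real ^ 'y)"
      have "\<bar>\<phi> (fst Q)\<bar> \<le> \<bar>B\<bar>" using B[of "fst Q"] by linarith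
      then show "norm (\<phi> (fst Q) *\<^sub>R D Q) \<le> norm (B *\<^sub>R D Q)" by (simp add: mult_right_mono)
    qed
  qed (use D in simp_all)
  have ae: "AE Q in lborel. \<phi> (fst Q) *\<^sub>R D Q = f \<alpha> T Q *\<^sub>R w Q"
    using DG by eventually_elim (simp add: w_def mult.commute)
  show "integrable lborel (\<lambda>Q. f \<alpha> T Q *\<^sub>R w Q)"
    by (rule integrable_cong_AE_imp[OF int]) (use ae in \<open>auto simp: w_def\<close>)
  have eq: "(\<integral>Q. \<phi> (fst Q) *\<^sub>R D Q \<partial>lborel) = (\<integral>Q. f \<alpha> T Q *\<^sub>R w Q \<partial>lborel)"
    by (rule integral_cong_AE) (use ae in \<open>auto simp: w_def\<close>)
  have "GDERIV (\<lambda>b. \<integral>Q. \<phi> (fst Q) * f b T Q \<partial>lborel) \<alpha> :> (\<integral>Q. f \<alpha> T Q *\<^sub>R w Q \<partial>lborel)"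
    unfolding eq[symmetric]
  proof (rule wd)
    show "continuous_on UNIV (\<lambda>Q. \<phi> (fst Q))" by (rule continuous_on_compose_fst[OF \<phi>(1)])
    show "bounded (range (\<lambda>Q. \<phi> (fst Q)))" using \<phi>(2) by (rule bounded_subset) auto
  qed
  then show "GDERIV (\<lambda>a. weak_moment \<phi> (marginal (f a T))) \<alpha> :> (\<integral>Q. f \<alpha> T Q *\<^sub>R w Q \<partial>lborel)"
    unfolding gderiv_def
    by (rule has_derivative_transform_within_open[OF _ open_A \<alpha>])
      (simp add: weak_moment_marginal(2)[OF _ TT \<phi>])
qed

end

section \<open>Independent products\<close>

context prob_space
begin

lemma indep_var_of_indep_vars:
  assumes "indep_vars M' X I" "i \<in> I" "j \<in> I" "i \<noteq> j"
  shows "indep_var (M' i) (X i) (M' j) (X j)"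
proof -
  have "indep_var (PiM {i} M') (\<lambda>\<omega>. restrict (\<lambda>i. X i \<omega>) {i}) (PiM {j} M') (\<lambda>\<omega>. restrict (\<lambda>i. X i \<omega>) {j})"
    using assms by (intro indep_var_restrict[OF assms(1)]) auto
  from indep_var_compose[OF this, of "\<lambda>x. x i" "M' i" "\<lambda>x. x j" "M' j"] show ?thesis
    by (simp add: o_def)
qed

text \<open>Both variables take values in the same type because \<open>indep_var\<close> requires it; the functions \<open>u\<close>
  and \<open>w\<close> then lead to different types.\<close>

lemma
  fixes u :: "'s \<Rightarrow> real" and w :: "'s \<Rightarrow> 'b::euclidean_space"
  assumes ind: "indep_var M1 Z1 M2 Z2" and u: "u \<in> borel_measurable M1" and w: "w \<in> borel_measurable M2"
  defines "X \<equiv> \<lambda>\<omega>. u (Z1 \<omega>)" and "Y \<equiv> \<lambda>\<omega>. w (Z2 \<omega>)"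
  assumes X: "integrable M X" and Y: "integrable M Y"
  shows indep_var_integrable_scaleR: "integrable M (\<lambda>\<omega>. X \<omega> *\<^sub>R Y \<omega>)"
    and indep_var_expectation_scaleR: "expectation (\<lambda>\<omega>. X \<omega> *\<^sub>R Y \<omega>) = expectation X *\<^sub>R expectation Y"
proof -
  have indv: "indep_var borel X borel (\<lambda>\<omega>. Y \<omega> \<bullet> v)" for v
    using indep_var_compose[OF ind u, of "\<lambda>z. w z \<bullet> v" borel] w by (simp add: o_def X_def Y_def)
  have i: "integrable M (\<lambda>\<omega>. X \<omega> * (Y \<omega> \<bullet> v))" for v
    using X Y by (intro indep_var_integrable[OF indv]) auto
  have "integrable M (\<lambda>\<omega>. \<Sum>v\<in>Basis. (X \<omega> * (Y \<omega> \<bullet> v)) *\<^sub>R v)"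
    using i by (intro Bochner_Integration.integrable_sum) auto
  moreover have "(\<Sum>v\<in>Basis. (X \<omega> * (Y \<omega> \<bullet> v)) *\<^sub>R v) = X \<omega> *\<^sub>R Y \<omega>" for \<omega>
    by (simp add: euclidean_representation flip: scaleR_scaleR scaleR_sum_right)
  ultimately show int: "integrable M (\<lambda>\<omega>. X \<omega> *\<^sub>R Y \<omega>)" by simp
  show "expectation (\<lambda>\<omega>. X \<omega> *\<^sub>R Y \<omega>) = expectation X *\<^sub>R expectation Y"
  proof (rule euclidean_eqI)
    fix v :: 'b
    have "expectation (\<lambda>\<omega>. X \<omega> *\<^sub>R Y \<omega>) \<bullet> v = expectation (\<lambda>\<omega>. X \<omega> * (Y \<omega> \<bullet> v))"
      using int by (simp flip: integral_inner_left)
    also have "\<dots> = expectation X * expectation (\<lambda>\<omega>. Y \<omega> \<bullet> v)"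
      using X Y by (intro indep_var_lebesgue_integral[OF indv]) auto
    also have "\<dots> = (expectation X *\<^sub>R expectation Y) \<bullet> v" using Y by simp
    finally show "expectation (\<lambda>\<omega>. X \<omega> *\<^sub>R Y \<omega>) \<bullet> v = (expectation X *\<^sub>R expectation Y) \<bullet> v" .
  qed
qed

text \<open>A crossed sum over distinct indices of an independent sample is an unbiased estimator of a
  product of expectations.\<close>

lemma crossed_sum_unbiased:
  fixes Z :: "nat \<Rightarrow> 'a \<Rightarrow> 's::topological_space" and u :: "'s \<Rightarrow> real" and w :: "'s \<Rightarrow> 'b::euclidean_space"
  assumes ind: "indep_vars (\<lambda>_. borel) Z {1..N}" and N: "2 \<le> N"
    and um: "u \<in> borel_measurable borel" and wm: "w \<in> borel_measurable borel"
    and u: "\<And>i. i \<in> {1..N} \<Longrightarrow> integrable M (\<lambda>\<omega>. u (Z i \<omega>))" "\<And>i. i \<in> {1..N} \<Longrightarrow> expectation (\<lambda>\<omega>. u (Z i \<omega>)) = eu"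
    and w: "\<And>i. i \<in> {1..N} \<Longrightarrow> integrable M (\<lambda>\<omega>. w (Z i \<omega>))" "\<And>i. i \<in> {1..N} \<Longrightarrow> expectation (\<lambda>\<omega>. w (Z i \<omega>)) = ew"
  defines "S \<equiv> \<lambda>\<omega>. (1 / (real N * (real N - 1))) *\<^sub>R
      (\<Sum>i=1..N. \<Sum>j\<in>{1..N} - {i}. u (Z i \<omega>) *\<^sub>R w (Z j \<omega>))"
  shows "integrable M S" and "expectation S = eu *\<^sub>R ew"
proof -
  have iv: "indep_var borel (Z i) borel (Z j)" if "i \<in> {1..N}" "j \<in> {1..N} - {i}" for i j
    using indep_var_of_indep_vars[OF ind, of i j] that by auto
  have int: "integrable M (\<lambda>\<omega>. u (Z i \<omega>) *\<^sub>R w (Z j \<omega>))"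
    if "i \<in> {1..N}" "j \<in> {1..N} - {i}" for i j
    using that by (intro indep_var_integrable_scaleR[OF iv um wm] u w) auto
  have ex: "expectation (\<lambda>\<omega>. u (Z i \<omega>) *\<^sub>R w (Z j \<omega>)) = eu *\<^sub>R ew"
    if "i \<in> {1..N}" "j \<in> {1..N} - {i}" for i j
    using indep_var_expectation_scaleR[OF iv[OF that] um wm u(1) w(1)] u(2) w(2) that by auto
  show "integrable M S" unfolding S_def
    using int by (intro integrable_scaleR_right Bochner_Integration.integrable_sum) auto
  have "expectation S = (1 / (real N * (real N - 1))) *\<^sub>R
      expectation (\<lambda>\<omega>. \<Sum>i=1..N. \<Sum>j\<in>{1..N} - {i}. u (Z i \<omega>) *\<^sub>R w (Z j \<omega>))"
    unfolding S_def by (rule integral_scaleR_right)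
  also have "expectation (\<lambda>\<omega>. \<Sum>i=1..N. \<Sum>j\<in>{1..N} - {i}. u (Z i \<omega>) *\<^sub>R w (Z j \<omega>))
      = (\<Sum>i=1..N. expectation (\<lambda>\<omega>. \<Sum>j\<in>{1..N} - {i}. u (Z i \<omega>) *\<^sub>R w (Z j \<omega>)))"
    by (intro Bochner_Integration.integral_sum Bochner_Integration.integrable_sum int)
  also have "\<dots> = (\<Sum>i=1..N. \<Sum>j\<in>{1..N} - {i}. expectation (\<lambda>\<omega>. u (Z i \<omega>) *\<^sub>R w (Z j \<omega>)))"
    by (intro sum.cong refl Bochner_Integration.integral_sum int)
  also have "(\<Sum>i=1..N. \<Sum>j\<in>{1..N} - {i}. expectation (\<lambda>\<omega>. u (Z i \<omega>) *\<^sub>R w (Z j \<omega>)))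
      = (\<Sum>i=1..N. \<Sum>j\<in>{1..N} - {i}. eu *\<^sub>R ew)"
    by (intro sum.cong refl ex)
  also have "\<dots> = (real N * (real N - 1)) *\<^sub>R (eu *\<^sub>R ew)"
    using N by (simp add: sum_constant_scaleR of_nat_diff)
  also have "(1 / (real N * (real N - 1))) *\<^sub>R \<dots> = eu *\<^sub>R ew" using N by simp
  finally show "expectation S = eu *\<^sub>R ew" .
qed

end

section \<open>Unbiasedness of the crossed estimator\<close>

theorem proposition3p6:
  fixes T :: real and A :: "(real ^ 'p) set" and \<alpha> :: "real ^ 'p"
    and R :: "real ^ 'p \<Rightarrow> real \<Rightarrow> (real ^ 'x) \<times> (real ^ 'y) \<Rightarrow> (real ^ 'x) \<times> (real ^ 'y)"
    and f0 :: "(real ^ 'x) \<times> (real ^ 'y) \<Rightarrow> real"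
    and \<Omega> :: "((real ^ 'x) \<times> (real ^ 'y)) set"
    and \<Phi> :: "real ^ 'p \<Rightarrow> real \<Rightarrow> (real ^ 'x) \<times> (real ^ 'y) \<Rightarrow> (real ^ 'x) \<times> (real ^ 'y)"
    and f :: "real ^ 'p \<Rightarrow> real \<Rightarrow> (real ^ 'x) \<times> (real ^ 'y) \<Rightarrow> real"
    and f_obs :: "real ^ 'x \<Rightarrow> real"
    and K N :: nat
    and \<phi> :: "nat \<Rightarrow> real ^ 'x \<Rightarrow> real"
    and M :: "'w measure"
    and q0 :: "nat \<Rightarrow> 'w \<Rightarrow> (real ^ 'x) \<times> (real ^ 'y)"
  assumes setting: "liouville_setting T A R f0 \<Omega> \<Phi> f"
    and joint_weakly_differentiable: "weakly_differentiable_at (\<lambda>a. f a T) \<alpha>"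
    and T_pos: "T > 0" and N_ge_2: "N \<ge> 2" and \<alpha>_in: "\<alpha> \<in> A"
    and f_obs_measurable: "f_obs \<in> borel_measurable borel"
    and f_obs_nonneg: "\<And>X. 0 \<le> f_obs X"
    and f_obs_prob: "prob_space (density lborel f_obs)"
    and test_functions: "\<And>k. k \<in> {1..K} \<Longrightarrow> continuous_on UNIV (\<phi> k) \<and> bounded (range (\<phi> k))"
    and M_prob: "prob_space M"
    and samples_indep: "prob_space.indep_vars M (\<lambda>_. borel) q0 {1..N}"
    and samples_distr: "\<And>n. n \<in> {1..N} \<Longrightarrow> distributed M lborel (q0 n) f0"
  shows "let \<mu> = (\<lambda>k a. weak_moment (\<phi> k) (marginal (f a T)));
             \<mu>_obs = (\<lambda>k. weak_moment (\<phi> k) f_obs);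
             J = (\<lambda>a. weak_loss K \<phi> f_obs (marginal (f a T)));
             q_T = (\<lambda>\<omega> n. \<Phi> \<alpha> T (q0 n \<omega>));
             g_hat = (\<lambda>\<omega>. crossed_estimator K N \<phi> \<mu>_obs (sensitivity \<Omega> \<Phi> f T \<alpha>) (q_T \<omega>))
         in (\<forall>k\<in>{1..K}. \<mu> k differentiable (at \<alpha>)) \<and>
            (GDERIV J \<alpha> :> (\<Sum>k=1..K. (\<mu> k \<alpha> - \<mu>_obs k) *\<^sub>R gradient (\<mu> k) \<alpha>)) \<and>
            integrable M g_hat \<and>
            prob_space.expectation M g_hat = gradient J \<alpha>"
proof -
  interpret liouville_setting T A R f0 \<Omega> \<Phi> f by (rule setting)
  interpret prob_space M by (rule M_prob)
  let ?I = "{1..K}"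
  define \<mu> where "\<mu> = (\<lambda>k a. weak_moment (\<phi> k) (marginal (f a T)))"
  define m where "m = (\<lambda>k. weak_moment (\<phi> k) f_obs)"
  define J where "J = (\<lambda>a. weak_loss K \<phi> f_obs (marginal (f a T)))"
  define G where "G = sensitivity \<Omega> \<Phi> f T \<alpha>"
  define Z where "Z = (\<lambda>n \<omega>. \<Phi> \<alpha> T (q0 n \<omega>))"
  define w where "w = (\<lambda>k Q. \<phi> k (fst Q) *\<^sub>R G Q)"
  define u where "u = (\<lambda>k (Q :: (real ^ 'x) \<times> (real ^ 'y)). \<phi> k (fst Q) - m k)"
  define g where "g = (\<lambda>\<omega>. crossed_estimator K N \<phi> m G (\<lambda>n. Z n \<omega>))"
  have TT: "T \<in> {0..T}" using T_pos by simp
  have \<phi>: "continuous_on UNIV (\<phi> k)" "bounded (range (\<phi> k))" if "k \<in> ?I" for k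
    using test_functions[OF that] by auto
  have \<phi>m: "(\<lambda>Q. \<phi> k (fst Q)) \<in> borel_measurable (borel :: ((real ^ 'x) \<times> (real ^ 'y)) measure)"
    if "k \<in> ?I" for k
    by (rule borel_measurable_continuous_onI[OF continuous_on_compose_fst[OF \<phi>(1)[OF that]]])
  have wm: "w k \<in> borel_measurable borel"
    and w_int: "integrable lborel (\<lambda>Q. f \<alpha> T Q *\<^sub>R w k Q)"
    and \<mu>_GDERIV: "GDERIV (\<mu> k) \<alpha> :> (\<integral>Q. f \<alpha> T Q *\<^sub>R w k Q \<partial>lborel)" if "k \<in> ?I" for k
    using weak_moment_GDERIV[OF \<alpha>_in T_pos joint_weakly_differentiable \<phi>[OF that]]
    unfolding \<mu>_def w_def G_def by simp_all
  have \<mu>_grad: "gradient (\<mu> k) \<alpha> = (\<integral>Q. f \<alpha> T Q *\<^sub>R w k Q \<partial>lborel)" if "k \<in> ?I" for k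
    by (rule GDERIV_imp_gradient[OF \<mu>_GDERIV[OF that]])
  have \<mu>_deriv: "GDERIV (\<mu> k) \<alpha> :> gradient (\<mu> k) \<alpha>" if "k \<in> ?I" for k
    using \<mu>_GDERIV[OF that] \<mu>_grad[OF that] by simp

  have J_deriv: "GDERIV J \<alpha> :> (\<Sum>k\<in>?I. (\<mu> k \<alpha> - m k) *\<^sub>R gradient (\<mu> k) \<alpha>)"
  proof -
    have "((\<lambda>a. 1/2 * (m k - \<mu> k a)\<^sup>2) has_derivative (\<lambda>h. h \<bullet> ((\<mu> k \<alpha> - m k) *\<^sub>R gradient (\<mu> k) \<alpha>))) (at \<alpha>)"
      if "k \<in> ?I" for k
    proof -
      have "((\<lambda>x. 1/2 * (m k - x)\<^sup>2) has_real_derivative (\<mu> k \<alpha> - m k)) (at (\<mu> k \<alpha>))"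
        by (auto intro!: derivative_eq_intros)
      from GDERIV_DERIV_compose[OF \<mu>_deriv[OF that] this] show ?thesis by (simp add: gderiv_def)
    qed
    then have "((\<lambda>a. \<Sum>k\<in>?I. 1/2 * (m k - \<mu> k a)\<^sup>2) has_derivative
        (\<lambda>h. \<Sum>k\<in>?I. h \<bullet> ((\<mu> k \<alpha> - m k) *\<^sub>R gradient (\<mu> k) \<alpha>))) (at \<alpha>)"
      by (intro has_derivative_sum) auto
    then show ?thesis
      unfolding gderiv_def J_def weak_loss_def \<mu>_def m_def inner_sum_right sum_distrib_left .
  qed

  have ind: "indep_vars (\<lambda>_. borel) Z {1..N}"
    unfolding Z_def by (rule indep_vars_compose2[OF samples_indep]) (rule flow_measurable[OF \<alpha>_in TT])
  have est: "integrable M (\<lambda>\<omega>. (1 / (real N * (real N - 1))) *\<^sub>R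
        (\<Sum>i=1..N. \<Sum>j\<in>{1..N} - {i}. u k (Z i \<omega>) *\<^sub>R w k (Z j \<omega>)))"
    "expectation (\<lambda>\<omega>. (1 / (real N * (real N - 1))) *\<^sub>R
        (\<Sum>i=1..N. \<Sum>j\<in>{1..N} - {i}. u k (Z i \<omega>) *\<^sub>R w k (Z j \<omega>)))
      = (\<mu> k \<alpha> - m k) *\<^sub>R gradient (\<mu> k) \<alpha>" if k: "k \<in> ?I" for k
  proof -
    have um: "u k \<in> borel_measurable borel" unfolding u_def using \<phi>m[OF k] by simp
    have moment: "integrable M (\<lambda>\<omega>. \<phi> k (fst (Z n \<omega>)))" "expectation (\<lambda>\<omega>. \<phi> k (fst (Z n \<omega>))) = \<mu> k \<alpha>"
      if n: "n \<in> {1..N}" for n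
    proof -
      note law = terminal_state_law[OF \<alpha>_in TT samples_distr[OF n] \<phi>m[OF k]]
      note mom = weak_moment_marginal[OF \<alpha>_in TT \<phi>[OF k]]
      show "integrable M (\<lambda>\<omega>. \<phi> k (fst (Z n \<omega>)))"
        unfolding Z_def law(1) using mom(1) by (simp add: mult.commute)
      show "expectation (\<lambda>\<omega>. \<phi> k (fst (Z n \<omega>))) = \<mu> k \<alpha>"
        unfolding Z_def law(2) \<mu>_def mom(2) by (simp add: mult.commute)
    qed
    have u: "integrable M (\<lambda>\<omega>. u k (Z n \<omega>))" "expectation (\<lambda>\<omega>. u k (Z n \<omega>)) = \<mu> k \<alpha> - m k"
      if n: "n \<in> {1..N}" for n
      using moment[OF n] by (auto simp: u_def prob_space)
    have w: "integrable M (\<lambda>\<omega>. w k (Z n \<omega>))" "expectation (\<lambda>\<omega>. w k (Z n \<omega>)) = gradient (\<mu> k) \<alpha>"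
      if n: "n \<in> {1..N}" for n
      unfolding Z_def terminal_state_law[OF \<alpha>_in TT samples_distr[OF n] wm[OF k]] \<mu>_grad[OF k]
      by (rule w_int[OF k]) (rule refl)
    note cs = crossed_sum_unbiased[OF ind N_ge_2 um wm[OF k] u w]
    show "integrable M (\<lambda>\<omega>. (1 / (real N * (real N - 1))) *\<^sub>R
        (\<Sum>i=1..N. \<Sum>j\<in>{1..N} - {i}. u k (Z i \<omega>) *\<^sub>R w k (Z j \<omega>)))" by (rule cs(1))
    show "expectation (\<lambda>\<omega>. (1 / (real N * (real N - 1))) *\<^sub>R
        (\<Sum>i=1..N. \<Sum>j\<in>{1..N} - {i}. u k (Z i \<omega>) *\<^sub>R w k (Z j \<omega>)))
      = (\<mu> k \<alpha> - m k) *\<^sub>R gradient (\<mu> k) \<alpha>" by (rule cs(2))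
  qed
  have g_eq: "g = (\<lambda>\<omega>. \<Sum>k\<in>?I. (1 / (real N * (real N - 1))) *\<^sub>R
        (\<Sum>i=1..N. \<Sum>j\<in>{1..N} - {i}. u k (Z i \<omega>) *\<^sub>R w k (Z j \<omega>)))"
    by (simp add: g_def crossed_estimator_def u_def w_def)
  have g_int: "integrable M g" unfolding g_eq by (intro Bochner_Integration.integrable_sum est)
  have "expectation g = (\<Sum>k\<in>?I. expectation (\<lambda>\<omega>. (1 / (real N * (real N - 1))) *\<^sub>R
        (\<Sum>i=1..N. \<Sum>j\<in>{1..N} - {i}. u k (Z i \<omega>) *\<^sub>R w k (Z j \<omega>))))"
    unfolding g_eq by (rule Bochner_Integration.integral_sum) (rule est(1))
  also have "\<dots> = (\<Sum>k\<in>?I. (\<mu> k \<alpha> - m k) *\<^sub>R gradient (\<mu> k) \<alpha>)"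
    by (intro sum.cong refl est(2))
  also have "\<dots> = gradient J \<alpha>" using GDERIV_imp_gradient[OF J_deriv] by simp
  finally have g_exp: "expectation g = gradient J \<alpha>" .
  have "\<forall>k\<in>?I. \<mu> k differentiable (at \<alpha>)" using \<mu>_deriv GDERIV_imp_differentiable by blast
  with J_deriv g_int g_exp show ?thesis
    unfolding Let_def \<mu>_def m_def J_def g_def G_def Z_def by blast
qed

end
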